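(* Consider the zero range dynamics on the complete graph with $L$ vertices and $N$ particles, with rate functions $c_x:\mathbb N\to[0,\infty)$, $x\in\{1,\dots,L\}$, such that $c_x(0)=0$ and $c_x(k)>0$ for $k\ge1$. Assume that there exist $c,\delta\ge0$ such that $$\delta\le c,\qquad c\le c_x(k+1)-c_x(k)\le c+\delta\quad\forall k\in\mathbb N,\ x\in\{1,\dots,L\}.$$ Then: (i) for every admissible $\phi$ the convex Sobolev inequality holds with $\kappa_\phi=c-\delta$; in particular the modified logarithmic Sobolev inequality holds with $\kappa_1=c-\delta$; (ii) for every $\alpha\in(1,2]$ the Beckner inequality holds with $\kappa_\alpha=\alpha c-\delta$.
   Context: Zero range dynamics: $\mathbb N=\{0,1,\dots\}$, state space $\Omega=\{\eta:\{1,\dots,L\}\to\mathbb N:\sum_{x=1}^L\eta_x=N\}$; moves $G=\{\gamma_{xy}:x,y\in\{1,\dots,L\}\}$ with $\gamma_{xy}\eta=\eta+\delta_y-\delta_x$ if $\eta_x>0$ and $\gamma_{xy}\eta=\eta$ otherwise, where $(\delta_x)_y=1$ if $y=x$ and $0$ otherwise; rates $c(\eta,\gamma_{xy})=\frac1Lc_x(\eta_x)$; generator $\mathcal Lf(\eta)=\frac1L\sum_{x,y\le L}c_x(\eta_x)(f(\gamma_{xy}\eta)-f(\eta))$; reversible probability measure $\mathbf m(\eta)=\frac1Z\prod_{x:\eta_x>0}\prod_{k=1}^{\eta_x}\frac1{c_x(k)}$. $\phi:[0,\infty)\to[0,\infty)$ is admissible if it is convex, twice differentiable on $(0,\infty)$,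 and $\Phi(a,b):=(\phi'(b)-\phi'(a))(b-a)$ is convex on $(0,\infty)^2$. $\mathcal H^\phi(f|\mathbf m)=\sum_\eta\phi(f(\eta))\mathbf m(\eta)-\phi\big(\sum_\eta f(\eta)\mathbf m(\eta)\big)$. The convex Sobolev inequality with constant $\kappa_\phi$ is: for all $f:\Omega\to(0,\infty)$, $$\kappa_\phi\,\mathcal H^\phi(f|\mathbf m)\le\frac12\sum_{\eta\in\Omega,\sigma\in G}c(\eta,\sigma)\,\Phi(f(\eta),f(\sigma\eta))\,\mathbf m(\eta).$$ Let $\phi_1(a)=a\log a-a+1$ and $\phi_\alpha(a)=\frac{1}{\alpha-1}(a^\alpha-a)-a+1$ for $\alpha\in(1,2]$. The modified logarithmic Sobolev inequality with constant $\kappa_1$ is the convex Sobolev inequality for $\phi=\phi_1$; the Beckner inequality with constant $\kappa_\alpha$ is the one for $\phi=\phi_\alpha$. *)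

theory Defs
  imports "HOL-Analysis.Analysis"
begin

definition zr_states :: "nat \<Rightarrow> nat \<Rightarrow> (nat \<Rightarrow> nat) set" where
  "zr_states L N = {\<eta> \<in> {1..L} \<rightarrow>\<^sub>E UNIV. (\<Sum>x=1..L. \<eta> x) = N}"

definition zr_delta :: "nat \<Rightarrow> nat \<Rightarrow> nat" where
  "zr_delta x y = (if y = x then 1 else 0)"

text \<open>
  The subtraction on the natural numbers does not truncate, since a particle is only
  removed from an occupied site.
\<close>

definition zr_move :: "nat \<Rightarrow> nat \<Rightarrow> (nat \<Rightarrow> nat) \<Rightarrow> (nat \<Rightarrow> nat)" where
  "zr_move x y \<eta> = (if \<eta> x > 0 then (\<lambda>z. \<eta> z + zr_delta y z - zr_delta x z) else \<eta>)"

text \<open>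
  The rate of the move from \<open>x\<close> to \<open>y\<close>; \<open>r x k\<close> stands for the rate function $c_x(k)$.
\<close>

definition zr_rate :: "nat \<Rightarrow> (nat \<Rightarrow> nat \<Rightarrow> real) \<Rightarrow> (nat \<Rightarrow> nat) \<Rightarrow> nat \<Rightarrow> nat \<Rightarrow> real" where
  "zr_rate L r \<eta> x y = 1 / real L * r x (\<eta> x)"

definition zr_weight :: "nat \<Rightarrow> (nat \<Rightarrow> nat \<Rightarrow> real) \<Rightarrow> (nat \<Rightarrow> nat) \<Rightarrow> real" where
  "zr_weight L r \<eta> = (\<Prod>x\<in>{x\<in>{1..L}. \<eta> x > 0}. \<Prod>k=1..\<eta> x. 1 / r x k)"

definition zr_partition :: "nat \<Rightarrow> nat \<Rightarrow> (nat \<Rightarrow> nat \<Rightarrow> real) \<Rightarrow> real" where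
  "zr_partition L N r = (\<Sum>\<eta>\<in>zr_states L N. zr_weight L r \<eta>)"

definition zr_measure :: "nat \<Rightarrow> nat \<Rightarrow> (nat \<Rightarrow> nat \<Rightarrow> real) \<Rightarrow> (nat \<Rightarrow> nat) \<Rightarrow> real" where
  "zr_measure L N r \<eta> = 1 / zr_partition L N r * zr_weight L r \<eta>"

definition Phi_of :: "(real \<Rightarrow> real) \<Rightarrow> real \<Rightarrow> real \<Rightarrow> real" where
  "Phi_of \<phi> a b = (deriv \<phi> b - deriv \<phi> a) * (b - a)"

text \<open>Values of \<open>\<phi>\<close> on the negative half-line are irrelevant junk.\<close>

definition admissible :: "(real \<Rightarrow> real) \<Rightarrow> bool" where
  "admissible \<phi> \<longleftrightarrow>
     (\<forall>a\<ge>0. \<phi> a \<ge> 0) \<and>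
     convex_on {0..} \<phi> \<and>
     \<phi> differentiable_on {0<..} \<and>
     deriv \<phi> differentiable_on {0<..} \<and>
     convex_on ({0<..} \<times> {0<..}) (\<lambda>(a, b). Phi_of \<phi> a b)"

definition zr_entropy ::
  "nat \<Rightarrow> nat \<Rightarrow> (nat \<Rightarrow> nat \<Rightarrow> real) \<Rightarrow> (real \<Rightarrow> real) \<Rightarrow> ((nat \<Rightarrow> nat) \<Rightarrow> real) \<Rightarrow> real" where
  "zr_entropy L N r \<phi> f =
     (\<Sum>\<eta>\<in>zr_states L N. \<phi> (f \<eta>) * zr_measure L N r \<eta>) -
     \<phi> (\<Sum>\<eta>\<in>zr_states L N. f \<eta> * zr_measure L N r \<eta>)"

text \<open>
  The sum over the moves $\gamma_{xy}$ is taken over the index pairs \<open>(x, y)\<close>, as in the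
  generator. All $\gamma_{xx}$ are the same map (the identity), but they contribute
  nothing, because \<open>Phi_of \<phi> a a = 0\<close>.
\<close>

definition convex_sobolev ::
  "nat \<Rightarrow> nat \<Rightarrow> (nat \<Rightarrow> nat \<Rightarrow> real) \<Rightarrow> (real \<Rightarrow> real) \<Rightarrow> real \<Rightarrow> bool" where
  "convex_sobolev L N r \<phi> \<kappa> \<longleftrightarrow>
     (\<forall>f. (\<forall>\<eta>\<in>zr_states L N. f \<eta> > 0) \<longrightarrow>
        \<kappa> * zr_entropy L N r \<phi> f \<le>
        1 / 2 * (\<Sum>\<eta>\<in>zr_states L N. \<Sum>x=1..L. \<Sum>y=1..L.
          zr_rate L r \<eta> x y * Phi_of \<phi> (f \<eta>) (f (zr_move x y \<eta>)) * zr_measure L N r \<eta>))"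

definition phi_one :: "real \<Rightarrow> real" where
  "phi_one a = a * ln a - a + 1"

definition phi_pow :: "real \<Rightarrow> real \<Rightarrow> real" where
  "phi_pow \<alpha> a = 1 / (\<alpha> - 1) * (a powr \<alpha> - a) - a + 1"

definition modified_log_sobolev :: "nat \<Rightarrow> nat \<Rightarrow> (nat \<Rightarrow> nat \<Rightarrow> real) \<Rightarrow> real \<Rightarrow> bool" where
  "modified_log_sobolev L N r \<kappa> \<longleftrightarrow> convex_sobolev L N r phi_one \<kappa>"

definition beckner :: "nat \<Rightarrow> nat \<Rightarrow> (nat \<Rightarrow> nat \<Rightarrow> real) \<Rightarrow> real \<Rightarrow> real \<Rightarrow> bool" where
  "beckner L N r \<alpha> \<kappa> \<longleftrightarrow> convex_sobolev L N r (phi_pow \<alpha>) \<kappa>"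

end

theory Submission
  imports Defs
begin

text \<open>
  Let \<open>f\<^sub>t\<close> be the flow of the generator started at \<open>f\<close>. The entropy of \<open>f\<^sub>t\<close> has derivative minus the
  Dirichlet form, so it suffices that the Dirichlet form decays at rate \<open>\<kappa>\<close>: then Dirichlet form
  minus \<open>\<kappa>\<close> times entropy decreases along the flow, and the entropy tends to zero.

  By reversibility the Dirichlet form is a sum over configurations \<open>\<zeta>\<close> with one particle less of
  the sum of \<open>\<Phi>(g\<^sub>x, g\<^sub>y)\<close> over all \<open>x, y\<close>, where \<open>g\<^sub>x = f(\<zeta> + \<delta>\<^sub>x)\<close>. The particles of \<open>\<zeta>\<close> jump
  simultaneously in all \<open>\<zeta> + \<delta>\<^sub>x\<close>; joint convexity of \<open>\<Phi>\<close> and stationarity show that this part does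
  not increase the sum. The rest is the averaging dynamics \<open>g\<^sub>x' = b\<^sub>x (m - g\<^sub>x)\<close>, where \<open>m\<close> is the mean
  of \<open>g\<close> and \<open>b\<^sub>x \<in> [c, c + \<delta>]\<close> is an increment of the rate. Speed \<open>c\<close> alone gives the rate \<open>c\<close>
  (respectively \<open>\<alpha> c\<close> for the Beckner densities). For the excess speeds, convexity and the identity
  that the sum of \<open>\<Phi>(m, g\<^sub>y)\<close> over \<open>y\<close> is half the average over \<open>x\<close> of the sums of \<open>\<Phi>(g\<^sub>x, g\<^sub>y)\<close> bound
  the loss by \<open>\<delta>\<close>.
\<close>

section \<open>The flow of a finite jump process\<close>

lemma jump_process_flow:
  fixes q :: "'i \<Rightarrow> 'a \<Rightarrow> real" and T :: "'i \<Rightarrow> 'a \<Rightarrow> 'a" and f :: "'a \<Rightarrow> real"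
  assumes S: "finite S" and I: "finite I"
    and T: "\<And>i x. i \<in> I \<Longrightarrow> x \<in> S \<Longrightarrow> T i x \<in> S"
    and q: "\<And>i x. i \<in> I \<Longrightarrow> x \<in> S \<Longrightarrow> q i x \<ge> 0"
    and f: "\<And>x. x \<in> S \<Longrightarrow> f x > 0"
  obtains u where "\<And>x. x \<in> S \<Longrightarrow> u 0 x = f x"
    and "\<And>t x. t \<ge> (0::real) \<Longrightarrow> x \<in> S \<Longrightarrow> u t x > 0"
    and "\<And>t x. x \<in> S \<Longrightarrow>
      ((\<lambda>s. u s x) has_real_derivative (\<Sum>i\<in>I. q i x * (u t (T i x) - u t x))) (at t)"
proof -
  \<comment> \<open>With \<open>K\<close> added to the generator it becomes a positive operator \<open>A\<close>, so the flow
    \<open>exp (- K t)\<close> times the exponential series of \<open>t A\<close> stays positive.\<close>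
  define K where "K = (\<Sum>x\<in>S. \<Sum>i\<in>I. q i x)"
  define A where "A g x = (\<Sum>i\<in>I. q i x * g (T i x)) + (K - (\<Sum>i\<in>I. q i x)) * g x" for g x
  define a where "a n = (A ^^ n) f" for n
  \<comment> \<open>The inserted 1 makes \<open>M\<close> well defined for empty \<open>S\<close>
    and visibly nonnegative.\<close>
  define M where "M = Max (insert 1 (f ` S))"
  have M: "f x \<le> M" if "x \<in> S" for x
    using S that unfolding M_def by (intro Max_ge) auto
  have M0: "M \<ge> 0"
    using Max_ge[of "insert 1 (f ` S)" 1] S unfolding M_def by (auto intro: order_trans[OF zero_le_one])
  have K: "(\<Sum>i\<in>I. q i x) \<le> K" if "x \<in> S" for x
    unfolding K_def using S q that
    by (intro member_le_sum[where f = "\<lambda>x. \<Sum>i\<in>I. q i x"]) (auto intro!: sum_nonneg)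
  have K0: "K \<ge> 0" unfolding K_def using q by (auto intro!: sum_nonneg)
  have a_Suc: "a (Suc n) x = A (a n) x" for n x unfolding a_def by simp
  \<comment> \<open>The coefficients of \<open>A\<close> at a state are nonnegative and add up to
    \<open>K\<close>. So \<open>A\<close> preserves positivity and enlarges upper bounds at most by
    the factor \<open>K\<close>; the second half gives an exponential majorant for the
    series.\<close>
  have bd: "0 \<le> a n x \<and> a n x \<le> K ^ n * M" if "x \<in> S" for n x
    using that
  proof (induction n arbitrary: x)
    case 0
    then show ?case using f M by (auto simp: a_def less_imp_le)
  next
    case (Suc n)
    have "0 \<le> A (a n) x"
      unfolding A_def using Suc T q K by (auto intro!: add_nonneg_nonneg sum_nonneg mult_nonneg_nonneg)
    moreover have "A (a n) x \<le> (\<Sum>i\<in>I. q i x * (K ^ n * M)) + (K - (\<Sum>i\<in>I. q i x)) * (K ^ n * M)"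
      unfolding A_def using Suc T q K by (intro add_mono sum_mono mult_left_mono) auto
    moreover have "\<dots> = K ^ Suc n * M"
      unfolding sum_distrib_right[symmetric] by (simp add: algebra_simps)
    ultimately show ?case by (simp add: a_Suc)
  qed
  have summ: "summable (\<lambda>n. a n x / fact n * t ^ n)" if "x \<in> S" for x t
  proof (rule summable_comparison_test'[where N = 0])
    show "summable (\<lambda>n. M * (inverse (fact n) * (K * \<bar>t\<bar>) ^ n))"
      by (intro summable_mult summable_exp)
    fix n
    have "\<bar>a n x\<bar> * \<bar>t\<bar> ^ n / fact n \<le> (K ^ n * M) * \<bar>t\<bar> ^ n / fact n"
      using bd[OF that] by (intro divide_right_mono mult_right_mono) auto
    then show "norm (a n x / fact n * t ^ n) \<le> M * (inverse (fact n) * (K * \<bar>t\<bar>) ^ n)"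
      by (simp add: abs_mult power_abs power_mult_distrib field_simps)
  qed
  define s where "s t x = (\<Sum>n. a n x / fact n * t ^ n)" for t x
  have sder: "((\<lambda>t. s t x) has_real_derivative A (s t) x) (at t)" if x: "x \<in> S" for t x
  proof -
    have d: "((\<lambda>t. s t x) has_real_derivative (\<Sum>n. diffs (\<lambda>n. a n x / fact n) n * t ^ n)) (at t)"
      unfolding s_def by (intro termdiffs_strong_converges_everywhere summ x)
    \<comment> \<open>Differentiating cancels one factor of the factorial and shifts the index,
      which applies \<open>A\<close> once more; hence \<open>s\<close> solves
      \<open>s' = A s\<close>.\<close>
    have "diffs (\<lambda>n. a n x / fact n) n * t ^ n =
        (\<Sum>i\<in>I. q i x * (a n (T i x) / fact n * t ^ n)) +
        (K - (\<Sum>i\<in>I. q i x)) * (a n x / fact n * t ^ n)" for n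
    proof -
      have "diffs (\<lambda>n. a n x / fact n) n = a (Suc n) x / fact n"
        unfolding diffs_def by (simp add: field_simps del: of_nat_Suc)
      then show ?thesis unfolding a_Suc A_def
        by (simp add: add_divide_distrib distrib_right sum_divide_distrib sum_distrib_right mult.assoc)
    qed
    moreover have "(\<lambda>n. (\<Sum>i\<in>I. q i x * (a n (T i x) / fact n * t ^ n)) +
        (K - (\<Sum>i\<in>I. q i x)) * (a n x / fact n * t ^ n)) sums A (s t) x"
      unfolding A_def s_def
      by (intro sums_add sums_sum sums_mult summable_sums summ T x)
    ultimately show ?thesis using d by (simp add: sums_iff)
  qed
  define u where "u t x = exp (- (K * t)) * s t x" for t x
  show ?thesis
  proof (rule that)
    show "u 0 x = f x" if "x \<in> S" for x
      unfolding u_def s_def using powser_zero[of "\<lambda>n. a n x / fact n"] by (simp add: a_def)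
  next
    fix t :: real and x assume "t \<ge> 0" and x: "x \<in> S"
    \<comment> \<open>All terms are nonnegative for \<open>t \<ge> 0\<close>, and the zeroth one is
      \<open>f x\<close>, which is positive.\<close>
    have "(\<Sum>n\<in>{0}. a n x / fact n * t ^ n) \<le> s t x"
      unfolding s_def using bd[OF x] \<open>t \<ge> 0\<close>
      by (intro sum_le_suminf summ x) auto
    then have "s t x \<ge> f x" by (simp add: a_def)
    then show "u t x > 0" unfolding u_def using f[OF x] by auto
  next
    fix t x assume x: "x \<in> S"
    have "((\<lambda>t. u t x) has_real_derivative
        exp (- (K * t)) * (- K) * s t x + A (s t) x * exp (- (K * t))) (at t)"
      unfolding u_def by (rule derivative_eq_intros sder x refl | simp)+
    also have "exp (- (K * t)) * (- K) * s t x + A (s t) x * exp (- (K * t)) =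
       (\<Sum>i\<in>I. q i x * (u t (T i x) - u t x))"
    proof -
      have "(\<Sum>i\<in>I. q i x * (u t (T i x) - u t x)) =
          (\<Sum>i\<in>I. exp (- (K * t)) * (q i x * s t (T i x)) - q i x * u t x)"
        unfolding u_def by (intro sum.cong) (simp_all add: algebra_simps)
      also have "\<dots> = exp (- (K * t)) * (\<Sum>i\<in>I. q i x * s t (T i x)) - (\<Sum>i\<in>I. q i x) * u t x"
        by (simp add: sum_subtractf sum_distrib_left sum_distrib_right)
      finally show ?thesis unfolding A_def u_def by (simp add: algebra_simps)
    qed
    finally show "((\<lambda>s. u s x) has_real_derivative (\<Sum>i\<in>I. q i x * (u t (T i x) - u t x))) (at t)" .
  qed
qed

section \<open>Densities and the averaging dynamics on a finite set\<close>

text \<open>The derivative of \<open>Phi p\<close> in its first argument, when \<open>q\<close> is the derivative of \<open>p\<close>. By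
  symmetry the derivative in the second argument is \<open>dPhi p q b a\<close>.\<close>

definition dPhi :: "(real \<Rightarrow> real) \<Rightarrow> (real \<Rightarrow> real) \<Rightarrow> real \<Rightarrow> real \<Rightarrow> real" where
  "dPhi p q a b = - (q a * (b - a)) - (p b - p a)"

definition Phi :: "(real \<Rightarrow> real) \<Rightarrow> real \<Rightarrow> real \<Rightarrow> real" where
  "Phi p a b = (p b - p a) * (b - a)"

text \<open>The last condition is joint convexity of \<open>Phi p\<close> in tangent form.\<close>

definition sobolev_density :: "(real \<Rightarrow> real) \<Rightarrow> (real \<Rightarrow> real) \<Rightarrow> (real \<Rightarrow> real) \<Rightarrow> bool" where
  "sobolev_density \<phi> p q \<longleftrightarrow>
     (\<forall>x>0. (\<phi> has_real_derivative p x) (at x)) \<and>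
     (\<forall>x>0. (p has_real_derivative q x) (at x)) \<and>
     mono_on {0<..} p \<and>
     (\<forall>a>0. \<forall>b>0. \<forall>a'>0. \<forall>b'>0.
        dPhi p q a b * (a' - a) + dPhi p q b a * (b' - b) \<le> Phi p a' b' - Phi p a b)"

lemma sobolev_density_tangent:
  assumes "sobolev_density \<phi> p q" "a > 0" "b > 0" "a' > 0" "b' > 0"
  shows "dPhi p q a b * (a' - a) + dPhi p q b a * (b' - b) \<le> Phi p a' b' - Phi p a b"
  using assms by (simp add: sobolev_density_def)

definition mean :: "nat set \<Rightarrow> (nat \<Rightarrow> real) \<Rightarrow> real" where
  "mean X g = (\<Sum>x\<in>X. g x) / card X"

text \<open>A decay rate of the double sum of \<open>Phi\<close> under the dynamics \<open>g\<^sub>x' = mean X g - g\<^sub>x\<close>.\<close>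

definition averaging_rate :: "real \<Rightarrow> (real \<Rightarrow> real) \<Rightarrow> (real \<Rightarrow> real) \<Rightarrow> bool" where
  "averaging_rate \<alpha> p q \<longleftrightarrow>
     (\<forall>X g. finite X \<longrightarrow> X \<noteq> {} \<longrightarrow> (\<forall>x\<in>X. g x > 0) \<longrightarrow>
        2 * (\<Sum>x\<in>X. \<Sum>y\<in>X. dPhi p q (g x) (g y) * (mean X g - g x))
          \<le> - \<alpha> * (\<Sum>x\<in>X. \<Sum>y\<in>X. Phi p (g x) (g y)))"

lemma mean_pos:
  assumes "finite X" "X \<noteq> {}" "\<And>x. x \<in> X \<Longrightarrow> g x > 0"
  shows "mean X g > 0"
  unfolding mean_def using assms by (intro divide_pos_pos sum_pos) (auto simp: card_gt_0_iff)

lemma sum_mean: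
  assumes "finite X" "X \<noteq> {}"
  shows "sum g X = card X * mean X g"
  using assms by (simp add: mean_def)

text \<open>Up to the factor \<open>2 * (card X)\<^sup>2\<close>, the double sum is the covariance
  of \<open>p (g x)\<close> and \<open>g x\<close> for uniformly distributed
  \<open>x\<close>.\<close>

lemma sum_Phi:
  fixes p :: "real \<Rightarrow> real" and g :: "nat \<Rightarrow> real"
  shows
  "(\<Sum>x\<in>X. \<Sum>y\<in>X. Phi p (g x) (g y)) =
     2 * (card X * (\<Sum>x\<in>X. p (g x) * g x) - (\<Sum>x\<in>X. p (g x)) * (\<Sum>x\<in>X. g x))"
proof -
  have "(\<Sum>x\<in>X. \<Sum>y\<in>X. Phi p (g x) (g y)) =
    (\<Sum>x\<in>X. \<Sum>y\<in>X. p (g y) * g y + p (g x) * g x - p (g y) * g x - p (g x) * g y)"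
    by (simp add: Phi_def algebra_simps)
  also have "\<dots> = 2 * (card X * (\<Sum>x\<in>X. p (g x) * g x) - (\<Sum>x\<in>X. p (g x)) * (\<Sum>x\<in>X. g x))"
    unfolding sum.distrib sum_subtractf sum_distrib_left[symmetric] sum_distrib_right[symmetric]
      sum_constant unfolding sum_distrib_left[symmetric] by (simp add: algebra_simps sum_distrib_left)
  finally show ?thesis .
qed

text \<open>The deviations of \<open>g\<close> from its mean sum to zero, so the terms with
  \<open>p (mean X g)\<close> cancel and the covariance of \<open>sum_Phi\<close> remains.\<close>

lemma sum_Phi_mean:
  fixes p :: "real \<Rightarrow> real" and g :: "nat \<Rightarrow> real"
  assumes "finite X" "X \<noteq> {}"
  shows "2 * (card X * (\<Sum>y\<in>X. Phi p (mean X g) (g y))) = (\<Sum>x\<in>X. \<Sum>y\<in>X. Phi p (g x) (g y))"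
proof -
  have "(\<Sum>y\<in>X. Phi p (mean X g) (g y)) =
    (\<Sum>y\<in>X. p (g y) * g y - p (g y) * mean X g - p (mean X g) * g y + p (mean X g) * mean X g)"
    by (simp add: Phi_def algebra_simps)
  also have "\<dots> = (\<Sum>x\<in>X. p (g x) * g x) - (\<Sum>x\<in>X. p (g x)) * mean X g"
    by (simp add: sum.distrib sum_subtractf sum_distrib_left[symmetric] sum_distrib_right[symmetric]
        sum_mean[OF assms])
  finally have *: "(\<Sum>y\<in>X. Phi p (mean X g) (g y)) =
    (\<Sum>x\<in>X. p (g x) * g x) - (\<Sum>x\<in>X. p (g x)) * mean X g" .
  show ?thesis unfolding * unfolding sum_Phi sum_mean[OF assms, of g]
    by (simp add: algebra_simps)
qed

lemma Phi_nonneg: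
  assumes "sobolev_density \<phi> p q" "a > 0" "b > 0"
  shows "Phi p a b \<ge> 0"
proof -
  have "mono_on {0<..} p" using assms by (simp add: sobolev_density_def)
  then have "a \<le> b \<Longrightarrow> p a \<le> p b" "b \<le> a \<Longrightarrow> p b \<le> p a"
    using assms by (auto simp: mono_on_def)
  then show ?thesis unfolding Phi_def by (cases "a \<le> b") (auto intro: mult_nonneg_nonneg mult_nonpos_nonpos)
qed

text \<open>The tangent inequality is applied with only the first argument moving, from
  \<open>g x\<close> to the mean; \<open>sum_Phi_mean\<close> then evaluates the sum at the
  mean.\<close>

lemma dPhi_mean_le:
  assumes d: "sobolev_density \<phi> p q" and X: "finite X" "X \<noteq> {}" and g: "\<And>x. x \<in> X \<Longrightarrow> g x > 0" and x: "x \<in> X"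
  shows "2 * card X * (\<Sum>y\<in>X. dPhi p q (g x) (g y) * (mean X g - g x)) \<le>
    (\<Sum>x\<in>X. \<Sum>y\<in>X. Phi p (g x) (g y)) - 2 * card X * (\<Sum>y\<in>X. Phi p (g x) (g y))"
proof -
  have "(\<Sum>y\<in>X. dPhi p q (g x) (g y) * (mean X g - g x)) \<le>
      (\<Sum>y\<in>X. Phi p (mean X g) (g y) - Phi p (g x) (g y))"
  proof (rule sum_mono)
    fix y assume "y \<in> X"
    then have "dPhi p q (g x) (g y) * (mean X g - g x) + dPhi p q (g y) (g x) * (g y - g y)
      \<le> Phi p (mean X g) (g y) - Phi p (g x) (g y)"
      using g x mean_pos[OF X g] by (intro sobolev_density_tangent[OF d]) auto
    then show "dPhi p q (g x) (g y) * (mean X g - g x) \<le> Phi p (mean X g) (g y) - Phi p (g x) (g y)"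
      by simp
  qed
  then have "2 * card X * (\<Sum>y\<in>X. dPhi p q (g x) (g y) * (mean X g - g x)) \<le>
     2 * card X * (\<Sum>y\<in>X. Phi p (mean X g) (g y) - Phi p (g x) (g y))"
    by (intro mult_left_mono) auto
  then show ?thesis unfolding sum_Phi_mean[OF X, symmetric] by (simp add: sum_subtractf algebra_simps)
qed

text \<open>Summing \<open>dPhi_mean_le\<close> over \<open>x\<close> leaves \<open>card X\<close>
  minus \<open>2 * card X\<close> times the double sum on the right, and \<open>card X\<close> is
  divided out.\<close>

lemma averaging_rate_1:
  assumes d: "sobolev_density \<phi> p q"
  shows "averaging_rate 1 p q"
  unfolding averaging_rate_def
proof (intro allI impI)
  fix X :: "nat set" and g :: "nat \<Rightarrow> real" assume X: "finite X" "X \<noteq> {}" and g: "\<forall>x\<in>X. g x > 0"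
  define t where "t x = (\<Sum>y\<in>X. dPhi p q (g x) (g y) * (mean X g - g x))" for x
  define s where "s x = (\<Sum>y\<in>X. Phi p (g x) (g y))" for x
  have "2 * card X * t x \<le> sum s X - 2 * card X * s x" if "x \<in> X" for x
    using dPhi_mean_le[OF d X, of g x] g that unfolding t_def s_def by simp
  then have "(\<Sum>x\<in>X. 2 * card X * t x) \<le> (\<Sum>x\<in>X. sum s X - 2 * card X * s x)"
    by (intro sum_mono)
  then have "card X * (2 * sum t X) \<le> card X * (- sum s X)"
    by (simp add: sum_subtractf sum_distrib_left[symmetric] mult.assoc mult.left_commute[of 2]
        mult.commute[of "sum s X"])
  then have "2 * sum t X \<le> - sum s X"
    by (rule mult_left_le_imp_le) (use X in \<open>simp add: card_gt_0_iff\<close>)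
  then show "2 * (\<Sum>x\<in>X. \<Sum>y\<in>X. dPhi p q (g x) (g y) * (mean X g - g x))
      \<le> - 1 * (\<Sum>x\<in>X. \<Sum>y\<in>X. Phi p (g x) (g y))"
    unfolding t_def s_def by simp
qed

text \<open>The speed splits as \<open>c + (b x - c)\<close>. The constant part decays by
  \<open>averaging_rate\<close>; each excess part costs at most \<open>\<delta> / card X\<close>
  times the double sum, and there are \<open>card X\<close> of them.\<close>

lemma perturbed_averaging:
  fixes \<alpha> c \<delta> :: real
  assumes d: "sobolev_density \<phi> p q" and \<alpha>: "averaging_rate \<alpha> p q"
    and X: "finite X" "X \<noteq> {}" and g: "\<And>x. x \<in> X \<Longrightarrow> g x > 0"
    and c: "c \<ge> 0" and b: "\<And>x. x \<in> X \<Longrightarrow> c \<le> b x" "\<And>x. x \<in> X \<Longrightarrow> b x \<le> c + \<delta>"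
  shows "2 * (\<Sum>x\<in>X. b x * (\<Sum>y\<in>X. dPhi p q (g x) (g y) * (mean X g - g x)))
     \<le> - (\<alpha> * c - \<delta>) * (\<Sum>x\<in>X. \<Sum>y\<in>X. Phi p (g x) (g y))"
proof -
  define t where "t x = (\<Sum>y\<in>X. dPhi p q (g x) (g y) * (mean X g - g x))" for x
  define s where "s x = (\<Sum>y\<in>X. Phi p (g x) (g y))" for x
  have s: "s x \<ge> 0" if "x \<in> X" for x
    unfolding s_def using Phi_nonneg[OF d] g that by (intro sum_nonneg) auto
  have card: "real (card X) > 0" using X by (simp add: card_gt_0_iff)
  have t: "2 * t x \<le> sum s X / card X" if "x \<in> X" for x
  proof -
    have "2 * card X * t x \<le> sum s X - 2 * card X * s x"
      using dPhi_mean_le[OF d X g that] unfolding t_def s_def by simp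
    also have "\<dots> \<le> sum s X" using s[OF that] by simp
    finally show ?thesis using card by (simp add: field_simps)
  qed
  have s0: "sum s X \<ge> 0" by (intro sum_nonneg s)
  have "2 * (\<Sum>x\<in>X. b x * t x) = c * (2 * sum t X) + (\<Sum>x\<in>X. (b x - c) * (2 * t x))"
    unfolding sum_distrib_left sum.distrib[symmetric] by (intro sum.cong) (auto simp: algebra_simps)
  also have "\<dots> \<le> c * (- \<alpha> * sum s X) + (\<Sum>x\<in>X. \<delta> * (sum s X / card X))"
  proof (intro add_mono mult_left_mono sum_mono c)
    show "2 * sum t X \<le> - \<alpha> * sum s X"
      using \<alpha> X g unfolding averaging_rate_def t_def s_def by blast
    fix x assume x: "x \<in> X"
    have "(b x - c) * (2 * t x) \<le> (b x - c) * (sum s X / card X)"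
      using t[OF x] b(1)[OF x] by (intro mult_left_mono) auto
    \<comment> \<open>Only the upper bound for \<open>t x\<close> is multiplied by the excess. It is
      nonnegative, so the sign of \<open>t x\<close> itself does not matter.\<close>
    also have "\<dots> \<le> \<delta> * (sum s X / card X)"
      using b(2)[OF x] s0 by (intro mult_right_mono) auto
    finally show "(b x - c) * (2 * t x) \<le> \<delta> * (sum s X / card X)" .
  qed
  also have "\<dots> = - (\<alpha> * c - \<delta>) * sum s X" using card by (simp add: field_simps)
  finally show ?thesis unfolding t_def s_def .
qed

text \<open>The equation between \<open>p\<close> and \<open>q\<close> is the one satisfied by
  derivatives of power functions. It trades \<open>g x * q (g x)\<close> for \<open>p (g x)\<close>,
  which raises the coefficient of the covariance from 1 to \<alpha>. What is left has a sign because
  \<open>q\<close> is nonincreasing.\<close>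

lemma averaging_rate_power:
  assumes pq: "\<And>x. x > 0 \<Longrightarrow> x * q x = (\<alpha> - 1) * p x + k"
    and q: "\<And>x y. 0 < x \<Longrightarrow> x \<le> y \<Longrightarrow> q y \<le> q x"
  shows "averaging_rate \<alpha> p q"
  unfolding averaging_rate_def
proof (intro allI impI)
  fix X :: "nat set" and g :: "nat \<Rightarrow> real" assume X: "finite X" "X \<noteq> {}" and g: "\<forall>x\<in>X. g x > 0"
  define n where "n = real (card X)"
  define m where "m = mean X g"
  have m: "m > 0" unfolding m_def using X g by (intro mean_pos) auto
  define P where "P = (\<Sum>x\<in>X. p (g x))"
  define R where "R = (\<Sum>x\<in>X. p (g x) * g x)"
  have G: "sum g X = n * m" unfolding n_def m_def using X by (rule sum_mean)
  have z: "(\<Sum>x\<in>X. m - g x) = 0" by (simp add: sum_subtractf G n_def)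
  have pR: "(\<Sum>x\<in>X. p (g x) * (m - g x)) = P * m - R"
    by (simp add: P_def R_def algebra_simps sum_subtractf sum_distrib_left[symmetric])
  \<comment> \<open>The last summand is a constant times \<open>m - g x\<close> and disappears on
    summation over \<open>x\<close>.\<close>
  have row: "(\<Sum>y\<in>X. dPhi p q (g x) (g y) * (m - g x)) =
     n * (- m * (q (g x) * (m - g x)) + \<alpha> * (p (g x) * (m - g x))) + (n * k - P) * (m - g x)"
    if "x \<in> X" for x
  proof -
    have "(\<Sum>y\<in>X. dPhi p q (g x) (g y)) = - q (g x) * (n * m - n * g x) - (P - n * p (g x))"
      unfolding dPhi_def sum_subtractf sum_negf sum_distrib_left[symmetric] G n_def P_def
      by simp
    also have "\<dots> = n * (- q (g x) * m + g x * q (g x) + p (g x)) - P"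
      by (simp add: algebra_simps)
    also have "\<dots> = n * (- q (g x) * m + \<alpha> * p (g x) + k) - P"
      using pq[of "g x"] g that by (simp add: algebra_simps)
    finally have *: "(\<Sum>y\<in>X. dPhi p q (g x) (g y)) =
      n * (- q (g x) * m + \<alpha> * p (g x) + k) - P" .
    show ?thesis unfolding sum_distrib_right[symmetric] * by (simp add: algebra_simps)
  qed
  have "(\<Sum>x\<in>X. \<Sum>y\<in>X. dPhi p q (g x) (g y) * (m - g x)) =
     n * (- m * (\<Sum>x\<in>X. q (g x) * (m - g x)) + \<alpha> * (P * m - R)) + (n * k - P) * 0"
    unfolding pR[symmetric] z[symmetric] sum_distrib_left sum.distrib[symmetric]
    using row by (intro sum.cong) auto
  \<comment> \<open>A Chebyshev argument: replacing \<open>q (g x)\<close> by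
    \<open>q (g x) - q m\<close> leaves the sum unchanged and makes every term nonnegative.\<close>
  moreover have "(\<Sum>x\<in>X. q (g x) * (m - g x)) \<ge> 0"
  proof -
    have "0 \<le> (q (g x) - q m) * (m - g x)" if "x \<in> X" for x
      using q[of "g x" m] q[of m "g x"] m g that
      by (cases "g x \<le> m") (auto intro: mult_nonneg_nonneg mult_nonpos_nonpos)
    then have "0 \<le> (\<Sum>x\<in>X. (q (g x) - q m) * (m - g x))" by (intro sum_nonneg)
    also have "\<dots> = (\<Sum>x\<in>X. q (g x) * (m - g x)) - q m * (\<Sum>x\<in>X. m - g x)"
      unfolding sum_distrib_left sum_subtractf[symmetric]
      by (intro sum.cong) (simp_all add: algebra_simps)
    finally show ?thesis unfolding z by simp
  qed
  then have "0 \<le> n * (m * (\<Sum>x\<in>X. q (g x) * (m - g x)))"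
    using m by (auto simp: n_def intro!: mult_nonneg_nonneg)
  ultimately show "2 * (\<Sum>x\<in>X. \<Sum>y\<in>X. dPhi p q (g x) (g y) * (mean X g - g x))
      \<le> - \<alpha> * (\<Sum>x\<in>X. \<Sum>y\<in>X. Phi p (g x) (g y))"
    unfolding sum_Phi G m_def[symmetric] n_def[symmetric] P_def[symmetric] R_def[symmetric]
    by (simp add: algebra_simps)
qed

section \<open>Joint convexity of \<open>Phi\<close> for admissible and for power densities\<close>

text \<open>Along the line from \<open>(a, b)\<close> to \<open>(a', b')\<close> the function is
  convex in \<open>t\<close>, so its value at 1 lies above the tangent at 0. The parameter set is
  open, which makes 0 an interior point.\<close>

lemma dPhi_tangent_of_convex:
  fixes p q :: "real \<Rightarrow> real"
  assumes p: "\<And>x. x > 0 \<Longrightarrow> (p has_real_derivative q x) (at x)"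
    and pos: "a > 0" "b > 0" "a' > 0" "b' > 0"
    and conv: "convex_on {t. 0 < a + t * (a' - a) \<and> 0 < b + t * (b' - b)}
      (\<lambda>t. Phi p (a + t * (a' - a)) (b + t * (b' - b)))"
  shows "dPhi p q a b * (a' - a) + dPhi p q b a * (b' - b) \<le> Phi p a' b' - Phi p a b"
proof -
  define A where "A = {t. 0 < a + t * (a' - a) \<and> 0 < b + t * (b' - b)}"
  define h where "h t = Phi p (a + t * (a' - a)) (b + t * (b' - b))" for t
  have "open A" unfolding A_def
    by (intro open_Collect_conj open_Collect_less continuous_intros)
  have "(h has_real_derivative dPhi p q a b * (a' - a) + dPhi p q b a * (b' - b)) (at 0)"
  proof -
    have 1: "((\<lambda>t. p (a + t * (a' - a))) has_real_derivative q a * (a' - a)) (at 0)"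
      by (rule DERIV_chain2[where f = p]) (auto intro!: derivative_eq_intros p pos)
    have 2: "((\<lambda>t. p (b + t * (b' - b))) has_real_derivative q b * (b' - b)) (at 0)"
      by (rule DERIV_chain2[where f = p]) (auto intro!: derivative_eq_intros p pos)
    show ?thesis unfolding h_def Phi_def dPhi_def
      by (rule derivative_eq_intros 1 2 refl | simp add: algebra_simps)+
  qed
  then have "(h has_real_derivative dPhi p q a b * (a' - a) + dPhi p q b a * (b' - b)) (at 0 within A)"
    by (rule has_field_derivative_at_within)
  moreover have "convex_on A h" using conv unfolding A_def h_def .
  moreover from this have "connected A" by (intro convex_connected) (simp add: convex_on_def)
  ultimately have "(dPhi p q a b * (a' - a) + dPhi p q b a * (b' - b)) * (1 - 0) \<le> h 1 - h 0"
    using pos \<open>open A\<close> by (intro convex_on_imp_above_tangent[of A]) (auto simp: interior_open A_def)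
  then show ?thesis by (simp add: h_def)
qed

text \<open>Convexity on the quadrant passes to every line, since the parametrisation is affine
  (\<open>aff\<close>).\<close>

lemma sobolev_density_of_convex:
  assumes "\<And>x. x > 0 \<Longrightarrow> (\<phi> has_real_derivative p x) (at x)"
    and p: "\<And>x. x > 0 \<Longrightarrow> (p has_real_derivative q x) (at x)"
    and "mono_on {0<..} p"
    and conv: "convex_on ({0<..} \<times> {0<..}) (\<lambda>(a, b). Phi p a b)"
  shows "sobolev_density \<phi> p q"
  unfolding sobolev_density_def
proof (intro conjI allI impI assms)
  fix a b a' b' :: real assume pos: "a > 0" "b > 0" "a' > 0" "b' > 0"
  let ?A = "{t. 0 < a + t * (a' - a) \<and> 0 < b + t * (b' - b)}"
  show "dPhi p q a b * (a' - a) + dPhi p q b a * (b' - b) \<le> Phi p a' b' - Phi p a b"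
  proof (rule dPhi_tangent_of_convex[OF p pos])
    have aff: "c + (v * s + w * t) * d = v * (c + s * d) + w * (c + t * d)"
      if "v + w = 1" for c d v w s t :: real
    proof -
      have "c = (v + w) * c" using that by simp
      then show ?thesis by (simp add: algebra_simps)
    qed
    have pos_comb: "0 < v * s + w * t" if "v \<ge> 0" "w \<ge> 0" "v + w = 1" "s > 0" "t > 0" for v w s t :: real
      using that by (cases "v = 0") (auto intro!: add_pos_nonneg)
    show "convex_on ?A (\<lambda>t. Phi p (a + t * (a' - a)) (b + t * (b' - b)))"
      unfolding convex_on_def
    proof (intro conjI ballI allI impI)
      show "convex ?A" unfolding convex_def by (auto simp: aff pos_comb)
    next
      fix s t v w :: real assume st: "s \<in> ?A" "t \<in> ?A" and vw: "0 \<le> v" "0 \<le> w" "v + w = 1"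
      have "(\<lambda>(a, b). Phi p a b) (v *\<^sub>R (a + s * (a' - a), b + s * (b' - b)) + w *\<^sub>R (a + t * (a' - a), b + t * (b' - b)))
        \<le> v * (\<lambda>(a, b). Phi p a b) (a + s * (a' - a), b + s * (b' - b))
        + w * (\<lambda>(a, b). Phi p a b) (a + t * (a' - a), b + t * (b' - b))"
        using conv st vw unfolding convex_on_def by blast
      then show "Phi p (a + (v *\<^sub>R s + w *\<^sub>R t) * (a' - a)) (b + (v *\<^sub>R s + w *\<^sub>R t) * (b' - b))
        \<le> v * Phi p (a + s * (a' - a)) (b + s * (b' - b)) + w * Phi p (a + t * (a' - a)) (b + t * (b' - b))"
        by (simp add: aff[OF vw(3)])
    qed
  qed
qed

lemma quadratic_form_nonneg:
  fixes A B C u v :: real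
  assumes "A > 0" "B\<^sup>2 \<le> A * C"
  shows "0 \<le> A * u\<^sup>2 - 2 * B * u * v + C * v\<^sup>2"
proof -
  have "0 \<le> (A * u - B * v)\<^sup>2 + (A * C - B\<^sup>2) * v\<^sup>2" using assms by simp
  also have "\<dots> = A * (A * u\<^sup>2 - 2 * B * u * v + C * v\<^sup>2)"
    by (simp add: algebra_simps power2_eq_square)
  finally show ?thesis using assms(1) by (simp add: zero_le_mult_iff)
qed

text \<open>This is nonnegativity of the Hessian determinant of \<open>Phi\<close> for the power
  densities, with \<open>\<gamma> = 2 - \<alpha>\<close> and the common factor \<alpha> removed.
  Weighted arithmetic-geometric means bound the ratios \<open>x / y\<close> and \<open>y / x\<close>
  by affine functions of \<open>b / a\<close> and \<open>a / b\<close>.\<close>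

lemma powr_hessian_det:
  fixes a b \<gamma> :: real
  assumes pos: "a > 0" "b > 0" and \<gamma>: "0 \<le> \<gamma>" "\<gamma> \<le> 1"
  defines "x \<equiv> a powr - \<gamma>" and "y \<equiv> b powr - \<gamma>"
  shows "(x + y)\<^sup>2 \<le> (x * (\<gamma> * (b / a) + 2 - \<gamma>)) * (y * (\<gamma> * (a / b) + 2 - \<gamma>))"
proof -
  have x: "x > 0" and y: "y > 0" using pos by (auto simp: x_def y_def)
  have young: "(s / t) powr \<gamma> \<le> 1 - \<gamma> + \<gamma> * (s / t)" if "s > 0" "t > 0" for s t :: real
    using Youngs_inequality_0[of \<gamma> "1 - \<gamma>" "s / t" 1] \<gamma> that by simp
  have xy: "x / y \<le> 1 - \<gamma> + \<gamma> * (b / a)"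
    using young[of b a] pos by (simp add: x_def y_def powr_minus powr_divide field_simps)
  have yx: "y / x \<le> 1 - \<gamma> + \<gamma> * (a / b)"
    using young[of a b] pos by (simp add: x_def y_def powr_minus powr_divide field_simps)
  define R where "R = b / a + a / b"
  have R: "R \<ge> 2"
  proof -
    have "0 \<le> (a - b)\<^sup>2 / (a * b)" using pos by simp
    also have "\<dots> = R - 2" using pos by (simp add: R_def field_simps power2_eq_square)
    finally show ?thesis by simp
  qed
  have "(x + y)\<^sup>2 = x * y * (x / y + y / x + 2)"
    using x y by (simp add: field_simps power2_eq_square)
  also have "\<dots> \<le> x * y * ((\<gamma> * (b / a) + 2 - \<gamma>) * (\<gamma> * (a / b) + 2 - \<gamma>))"
  proof (rule mult_left_mono)
    have "x / y + y / x + 2 \<le> 4 - 2 * \<gamma> + \<gamma> * R"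
      using add_mono[OF xy yx] by (simp add: R_def algebra_simps)
    \<comment> \<open>The added term is exactly what completes the product on the right; it is
      nonnegative because a positive number and its reciprocal sum to at least 2.\<close>
    also have "\<dots> \<le> 4 - 2 * \<gamma> + \<gamma> * R + \<gamma> * (1 - \<gamma>) * (R - 2)"
      using \<gamma> R by simp
    also have "\<dots> = (\<gamma> * (b / a) + 2 - \<gamma>) * (\<gamma> * (a / b) + 2 - \<gamma>)"
      using pos by (simp add: R_def field_simps)
    finally show "x / y + y / x + 2 \<le> (\<gamma> * (b / a) + 2 - \<gamma>) * (\<gamma> * (a / b) + 2 - \<gamma>)" .
  qed (use x y in auto)
  finally show ?thesis by (simp add: mult_ac)
qed

text \<open>Convexity is checked along lines by the sign of the second derivative, a binary
  quadratic form in the direction \<open>(u, v)\<close>. The exponent \<open>\<alpha> = 1\<close> is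
  included for the logarithm.\<close>

lemma sobolev_density_power:
  fixes \<alpha> :: real
  assumes \<alpha>: "1 \<le> \<alpha>" "\<alpha> \<le> 2"
    and \<phi>: "\<And>x. x > 0 \<Longrightarrow> (\<phi> has_real_derivative p x) (at x)"
    and p: "\<And>x. x > 0 \<Longrightarrow> (p has_real_derivative \<alpha> * x powr (\<alpha> - 2)) (at x)"
  shows "sobolev_density \<phi> p (\<lambda>x. \<alpha> * x powr (\<alpha> - 2))"
  unfolding sobolev_density_def
proof (intro conjI allI impI \<phi> p)
  show "mono_on {0<..} p"
  proof (rule mono_onI)
    fix x y :: real assume "x \<in> {0<..}" "y \<in> {0<..}" "x \<le> y"
    then show "p x \<le> p y"
      using \<alpha> by (intro DERIV_nonneg_imp_nondecreasing[of x y p])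
        (auto intro!: exI[of _ "\<alpha> * _ powr (\<alpha> - 2)"] p)
  qed
next
  fix a b a' b' :: real assume pos: "a > 0" "b > 0" "a' > 0" "b' > 0"
  define q where "q x = \<alpha> * x powr (\<alpha> - 2)" for x
  define s where "s x = \<alpha> * ((\<alpha> - 2) * x powr (\<alpha> - 3))" for x
  define u where "u = a' - a"
  define v where "v = b' - b"
  let ?A = "{t. 0 < a + t * u \<and> 0 < b + t * v}"
  let ?X = "\<lambda>t. a + t * u" and ?Y = "\<lambda>t. b + t * v"
  have q': "(q has_real_derivative s x) (at x)" if "x > 0" for x
    unfolding q_def s_def using that by (auto intro!: derivative_eq_intros)
  have p': "(p has_real_derivative q x) (at x)" if "x > 0" for x
    unfolding q_def using p that .
  have pX: "((\<lambda>t. p (c + t * d)) has_real_derivative q (c + t * d) * d) (at t)"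
    if "c + t * d > 0" for c d t
    by (rule DERIV_chain2[where f = p]) (auto intro!: derivative_eq_intros p' that)
  have qX: "((\<lambda>t. q (c + t * d)) has_real_derivative s (c + t * d) * d) (at t)"
    if "c + t * d > 0" for c d t
    by (rule DERIV_chain2[where f = q]) (auto intro!: derivative_eq_intros q' that)
  have "dPhi p q a b * (a' - a) + dPhi p q b a * (b' - b) \<le> Phi p a' b' - Phi p a b"
  proof (rule dPhi_tangent_of_convex[OF p' pos], unfold u_def[symmetric] v_def[symmetric])
    \<comment> \<open>The Hessian of \<open>Phi p\<close> at \<open>(x, y)\<close> applied twice to
      the direction \<open>(u, v)\<close>.\<close>
    let ?h = "\<lambda>x y. (2 * q x - s x * (y - x)) * u\<^sup>2 - 2 * (q x + q y) * u * v + (2 * q y - s y * (x - y)) * v\<^sup>2"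
    show "convex_on ?A (\<lambda>t. Phi p (?X t) (?Y t))"
    proof (rule f''_ge0_imp_convex)
      show "convex ?A"
      proof -
        have "?A = {t. - a < u * t} \<inter> {t. - b < v * t}" by (auto simp: algebra_simps)
        moreover have "convex {t. - a < u * t}" "convex {t. - b < v * t}"
          using convex_halfspace_gt[of "-a" u] convex_halfspace_gt[of "-b" v] by simp_all
        ultimately show ?thesis by (simp add: convex_Int)
      qed
    next
      fix t assume "t \<in> ?A"
      then show "((\<lambda>t. Phi p (?X t) (?Y t)) has_real_derivative
          dPhi p q (?X t) (?Y t) * u + dPhi p q (?Y t) (?X t) * v) (at t)"
        unfolding Phi_def dPhi_def
        by (auto intro!: derivative_eq_intros pX simp: algebra_simps)
    next
      fix t assume "t \<in> ?A"
      then show "((\<lambda>t. dPhi p q (?X t) (?Y t) * u + dPhi p q (?Y t) (?X t) * v) has_real_derivative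
          ?h (?X t) (?Y t)) (at t)"
        unfolding dPhi_def
        by (auto intro!: derivative_eq_intros pX qX simp: algebra_simps power2_eq_square)
    next
      fix t assume "t \<in> ?A"
      moreover have "0 \<le> ?h x y" if xy: "x > 0" "y > 0" for x y
      proof -
        \<comment> \<open>In terms of \<gamma>, the coefficients of \<open>?h\<close> are \<alpha>
          times the quantities in \<open>powr_hessian_det\<close>.\<close>
        define \<gamma> where "\<gamma> = 2 - \<alpha>"
        have s: "s z = - (\<alpha> * (\<gamma> * (z powr - \<gamma> / z)))" if "z > 0" for z
          using that powr_diff[of z "- \<gamma>" 1] by (simp add: s_def \<gamma>_def algebra_simps diff_divide_distrib)
        have q: "q z = \<alpha> * z powr - \<gamma>" for z
          by (simp add: q_def \<gamma>_def)
        define A where "A = x powr - \<gamma> * (\<gamma> * (y / x) + 2 - \<gamma>)"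
        define C where "C = y powr - \<gamma> * (\<gamma> * (x / y) + 2 - \<gamma>)"
        define B where "B = x powr - \<gamma> + y powr - \<gamma>"
        have "A > 0"
          unfolding A_def using xy \<alpha> by (intro mult_pos_pos) (auto simp: \<gamma>_def add_nonneg_pos)
        moreover have "B\<^sup>2 \<le> A * C"
          unfolding A_def B_def C_def by (rule powr_hessian_det) (use xy \<alpha> in \<open>auto simp: \<gamma>_def\<close>)
        ultimately have "0 \<le> \<alpha> * (A * u\<^sup>2 - 2 * B * u * v + C * v\<^sup>2)"
          using quadratic_form_nonneg[of A B C u v] \<alpha> by (intro mult_nonneg_nonneg) auto
        also have "\<dots> = (\<alpha> * A) * u\<^sup>2 - 2 * (\<alpha> * B) * u * v + (\<alpha> * C) * v\<^sup>2"
          by (simp add: algebra_simps)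
        also have "\<alpha> * A = 2 * q x - s x * (y - x)"
          using xy by (simp add: A_def q s field_simps)
        also have "\<alpha> * C = 2 * q y - s y * (x - y)"
          using xy by (simp add: C_def q s field_simps)
        also have "\<alpha> * B = q x + q y" by (simp add: B_def q algebra_simps)
        finally show ?thesis .
      qed
      ultimately show "0 \<le> ?h (?X t) (?Y t)" by simp
    qed
  qed
  then show "dPhi p (\<lambda>x. \<alpha> * x powr (\<alpha> - 2)) a b * (a' - a) + dPhi p (\<lambda>x. \<alpha> * x powr (\<alpha> - 2)) b a * (b' - b)
     \<le> Phi p a' b' - Phi p a b"
    unfolding q_def .
qed

lemma sobolev_density_phi_one:
  "sobolev_density phi_one ln (\<lambda>x. 1 * x powr (1 - 2))"
proof (rule sobolev_density_power)
  fix x :: real assume "x > 0"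
  then show "(phi_one has_real_derivative ln x) (at x)"
    unfolding phi_one_def by (auto intro!: derivative_eq_intros)
  show "(ln has_real_derivative 1 * x powr (1 - 2)) (at x)"
    using \<open>x > 0\<close> by (auto intro!: derivative_eq_intros simp: powr_minus divide_inverse)
qed auto

definition phi_pow' :: "real \<Rightarrow> real \<Rightarrow> real" where
  "phi_pow' \<alpha> x = (\<alpha> * x powr (\<alpha> - 1) - 1) / (\<alpha> - 1) - 1"

lemma sobolev_density_phi_pow:
  assumes "1 < \<alpha>" "\<alpha> \<le> 2"
  shows "sobolev_density (phi_pow \<alpha>) (phi_pow' \<alpha>) (\<lambda>x. \<alpha> * x powr (\<alpha> - 2))"
proof (rule sobolev_density_power)
  fix x :: real assume x: "x > 0"
  show "(phi_pow \<alpha> has_real_derivative phi_pow' \<alpha> x) (at x)"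
    unfolding phi_pow_def phi_pow'_def using x assms by (auto intro!: derivative_eq_intros)
  show "(phi_pow' \<alpha> has_real_derivative \<alpha> * x powr (\<alpha> - 2)) (at x)"
    unfolding phi_pow'_def using x assms by (auto intro!: derivative_eq_intros)
qed (use assms in auto)

text \<open>The additive constant in \<open>averaging_rate_power\<close> is \<alpha> here, and
  \<open>\<alpha> \<le> 2\<close> makes the second derivative nonincreasing.\<close>

lemma averaging_rate_phi_pow:
  assumes "1 < \<alpha>" "\<alpha> \<le> 2"
  shows "averaging_rate \<alpha> (phi_pow' \<alpha>) (\<lambda>x. \<alpha> * x powr (\<alpha> - 2))"
proof (rule averaging_rate_power)
  fix x :: real assume x: "x > 0"
  have "x * x powr (\<alpha> - 2) = x powr (\<alpha> - 1)"
    using x powr_add[of x 1 "\<alpha> - 2"] by simp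
  then show "x * (\<alpha> * x powr (\<alpha> - 2)) = (\<alpha> - 1) * phi_pow' \<alpha> x + \<alpha>"
    using assms by (simp add: phi_pow'_def field_simps)
next
  fix x y :: real assume "0 < x" "x \<le> y"
  then show "\<alpha> * y powr (\<alpha> - 2) \<le> \<alpha> * x powr (\<alpha> - 2)"
    using assms by (intro mult_left_mono powr_mono2') auto
qed

lemma sobolev_density_admissible:
  assumes "admissible \<phi>"
  shows "sobolev_density \<phi> (deriv \<phi>) (deriv (deriv \<phi>))"
proof (rule sobolev_density_of_convex)
  have 1: "\<phi> differentiable_on {0<..}" and 2: "deriv \<phi> differentiable_on {0<..}"
    and conv: "convex_on {0..} \<phi>"
    using assms by (auto simp: admissible_def)
  show der: "(\<phi> has_real_derivative deriv \<phi> x) (at x)" if "x > 0" for x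
    using 1 that unfolding differentiable_on_def
    by (metis DERIV_deriv_iff_real_differentiable at_within_open greaterThan_iff open_greaterThan)
  show "(deriv \<phi> has_real_derivative deriv (deriv \<phi>) x) (at x)" if "x > 0" for x
    using 2 that unfolding differentiable_on_def
    by (metis DERIV_deriv_iff_real_differentiable at_within_open greaterThan_iff open_greaterThan)
  show "mono_on {0<..} (deriv \<phi>)"
  proof (rule mono_onI)
    fix x y :: real assume xy: "x \<in> {0<..}" "y \<in> {0<..}" "x \<le> y"
    have tangent: "deriv \<phi> s * (t - s) \<le> \<phi> t - \<phi> s" if "s > 0" "t > 0" for s t
      using that conv der[OF that(1)]
      by (intro convex_on_imp_above_tangent[of "{0..}"])
        (auto simp: interior_real_atLeast intro: has_field_derivative_at_within)
    \<comment> \<open>The sum of the tangent inequalities from \<open>x\<close> to \<open>y\<close>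
      and from \<open>y\<close> to \<open>x\<close>.\<close>
    have "(deriv \<phi> y - deriv \<phi> x) * (y - x) \<ge> 0"
      using tangent[of x y] tangent[of y x] xy by (simp add: algebra_simps)
    then show "deriv \<phi> x \<le> deriv \<phi> y"
      using xy by (cases "x = y") (auto simp: zero_le_mult_iff)
  qed
  show "convex_on ({0<..} \<times> {0<..}) (\<lambda>(a, b). Phi (deriv \<phi>) a b)"
    using assms by (simp add: admissible_def Phi_of_def Phi_def)
qed

section \<open>Configurations with one particle added or removed\<close>

definition add_particle :: "nat \<Rightarrow> (nat \<Rightarrow> nat) \<Rightarrow> nat \<Rightarrow> nat" where
  "add_particle x \<zeta> = \<zeta>(x := Suc (\<zeta> x))"

lemma add_particle_in_states:
  assumes "x \<in> {1..L}" "\<zeta> \<in> zr_states L M"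
  shows "add_particle x \<zeta> \<in> zr_states L (Suc M)"
proof -
  have "(\<Sum>z=1..L. add_particle x \<zeta> z) = (\<Sum>z=1..L. \<zeta> z + (if z = x then 1 else 0))"
    by (intro sum.cong) (auto simp: add_particle_def)
  then have "(\<Sum>z=1..L. add_particle x \<zeta> z) = Suc M"
    using assms by (simp add: sum.distrib zr_states_def)
  moreover have "add_particle x \<zeta> \<in> {1..L} \<rightarrow>\<^sub>E UNIV"
    using assms by (auto simp: zr_states_def add_particle_def PiE_def extensional_def)
  ultimately show ?thesis by (simp add: zr_states_def)
qed

lemma remove_particle:
  assumes "x \<in> {1..L}" "\<eta> \<in> zr_states L (Suc M)" "\<eta> x > 0"
  obtains \<zeta> where "\<zeta> \<in> zr_states L M" "\<eta> = add_particle x \<zeta>"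
proof
  let ?\<zeta> = "\<eta>(x := \<eta> x - 1)"
  show eq: "\<eta> = add_particle x ?\<zeta>" using assms by (auto simp: add_particle_def)
  have "(\<Sum>z=1..L. \<eta> z) = (\<Sum>z=1..L. ?\<zeta> z + (if z = x then 1 else 0))"
    using assms by (intro sum.cong) auto
  then have "(\<Sum>z=1..L. ?\<zeta> z) = M"
    using assms by (simp add: sum.distrib zr_states_def del: fun_upd_apply)
  moreover have "?\<zeta> \<in> {1..L} \<rightarrow>\<^sub>E UNIV"
    using assms by (auto simp: zr_states_def PiE_def extensional_def)
  ultimately show "?\<zeta> \<in> zr_states L M" by (simp add: zr_states_def)
qed

text \<open>The states \<open>add_particle x \<zeta>\<close> for fixed \<zeta> are thus all joined
  by single jumps, and every jump belongs to such a family.\<close>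

lemma zr_move_add_particle: "zr_move x y (add_particle x \<zeta>) = add_particle y \<zeta>"
  by (auto simp: zr_move_def add_particle_def zr_delta_def fun_eq_iff)

text \<open>A particle of \<zeta> jumps regardless of the added one. If \<open>z\<close> were empty
  in \<zeta> and equal to \<open>x\<close>, the left side would move the added particle
  instead.\<close>

lemma zr_move_add_particle':
  assumes "\<zeta> z > 0"
  shows "zr_move z y (add_particle x \<zeta>) = add_particle x (zr_move z y \<zeta>)"
  using assms by (auto simp: zr_move_def add_particle_def zr_delta_def fun_eq_iff)

lemma zr_move_empty: "\<eta> x = 0 \<Longrightarrow> zr_move x y \<eta> = \<eta>"
  by (simp add: zr_move_def)

lemma occupied_imp_Suc:
  assumes "\<eta> \<in> zr_states L N" "x \<in> {1..L}" "\<eta> x > 0"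
  obtains M where "N = Suc M"
proof -
  have "\<eta> x \<le> (\<Sum>z=1..L. \<eta> z)" using assms by (intro member_le_sum) auto
  then show ?thesis using assms that by (cases N) (auto simp: zr_states_def)
qed

lemma zr_move_in_states:
  assumes "x \<in> {1..L}" "y \<in> {1..L}" "\<eta> \<in> zr_states L N"
  shows "zr_move x y \<eta> \<in> zr_states L N"
proof (cases "\<eta> x > 0")
  case True
  then obtain M where N: "N = Suc M" using assms occupied_imp_Suc by metis
  obtain \<zeta> where "\<zeta> \<in> zr_states L M" "\<eta> = add_particle x \<zeta>"
    using remove_particle[of x L \<eta> M] assms N True by blast
  then show ?thesis using assms N by (simp add: zr_move_add_particle add_particle_in_states)
qed (use assms in \<open>simp add: zr_move_empty\<close>)

lemma finite_zr_states: "finite (zr_states L N)"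
proof (rule finite_subset)
  show "zr_states L N \<subseteq> {1..L} \<rightarrow>\<^sub>E {..N}"
  proof
    fix \<eta> assume \<eta>: "\<eta> \<in> zr_states L N"
    have "\<eta> x \<le> N" if "x \<in> {1..L}" for x
    proof -
      have "\<eta> x \<le> (\<Sum>z=1..L. \<eta> z)" using that by (intro member_le_sum) auto
      then show ?thesis using \<eta> by (simp add: zr_states_def)
    qed
    then show "\<eta> \<in> {1..L} \<rightarrow>\<^sub>E {..N}" using \<eta> by (auto simp: zr_states_def PiE_iff)
  qed
qed (auto intro: finite_PiE)

lemma sum_delta_antisym:
  fixes g :: "nat \<Rightarrow> real"
  shows "(\<Sum>x\<in>X. \<Sum>y\<in>X. g y - g x) = 0"
  by (simp add: sum_subtractf sum_distrib_left)

section \<open>Reversibility and the decay estimate for the edge form\<close>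

definition zr_generator :: "nat \<Rightarrow> (nat \<Rightarrow> nat \<Rightarrow> real) \<Rightarrow> ((nat \<Rightarrow> nat) \<Rightarrow> real) \<Rightarrow> (nat \<Rightarrow> nat) \<Rightarrow> real" where
  "zr_generator L r f \<eta> = (\<Sum>x=1..L. \<Sum>y=1..L. zr_rate L r \<eta> x y * (f (zr_move x y \<eta>) - f \<eta>))"

text \<open>Summed against \<open>zr_weight\<close> over the states with \<open>M\<close> particles, this is
  \<open>2 * L * zr_partition L (Suc M) r\<close> times the right-hand side of the convex Sobolev inequality for
  \<open>Suc M\<close> particles.\<close>

definition edge_form ::
  "(real \<Rightarrow> real) \<Rightarrow> nat \<Rightarrow> ((nat \<Rightarrow> nat) \<Rightarrow> real) \<Rightarrow> (nat \<Rightarrow> nat) \<Rightarrow> real" where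
  "edge_form p L f \<zeta> = (\<Sum>x=1..L. \<Sum>y=1..L. Phi p (f (add_particle x \<zeta>)) (f (add_particle y \<zeta>)))"

text \<open>The factor 2 accounts for the derivatives in the second argument of \<open>Phi\<close>, by symmetry of the
  double sum.\<close>

definition edge_form_deriv ::
  "(real \<Rightarrow> real) \<Rightarrow> (real \<Rightarrow> real) \<Rightarrow> nat \<Rightarrow> ((nat \<Rightarrow> nat) \<Rightarrow> real) \<Rightarrow> ((nat \<Rightarrow> nat) \<Rightarrow> real) \<Rightarrow>
    (nat \<Rightarrow> nat) \<Rightarrow> real" where
  "edge_form_deriv p q L f h \<zeta> = 2 * (\<Sum>x=1..L. \<Sum>y=1..L.
     dPhi p q (f (add_particle x \<zeta>)) (f (add_particle y \<zeta>)) * h (add_particle x \<zeta>))"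

locale zero_range =
  fixes L :: nat and r :: "nat \<Rightarrow> nat \<Rightarrow> real"
  assumes L: "L \<ge> 1"
    and r_0: "x \<in> {1..L} \<Longrightarrow> r x 0 = 0"
    and r_pos: "x \<in> {1..L} \<Longrightarrow> k \<ge> 1 \<Longrightarrow> r x k > 0"
begin

lemma r_nonneg: "x \<in> {1..L} \<Longrightarrow> r x k \<ge> 0"
  using r_0 r_pos[of x k] by (cases k) (auto simp: less_imp_le)

lemma zr_weight_eq: "zr_weight L r \<eta> = (\<Prod>x=1..L. \<Prod>k=1..\<eta> x. 1 / r x k)"
  unfolding zr_weight_def by (intro prod.mono_neutral_left) auto

lemma zr_weight_pos: "zr_weight L r \<eta> > 0"
  unfolding zr_weight_eq using r_pos by (intro prod_pos) auto

text \<open>Adding the particle contributes exactly one new factor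
  \<open>1 / r x (Suc (\<zeta> x))\<close> to the product; this is the source of detailed
  balance.\<close>

lemma zr_weight_add_particle:
  assumes "x \<in> {1..L}"
  shows "zr_weight L r (add_particle x \<zeta>) * r x (Suc (\<zeta> x)) = zr_weight L r \<zeta>"
proof -
  have split: "zr_weight L r \<eta> = (\<Prod>k=1..\<eta> x. 1 / r x k) * (\<Prod>z\<in>{1..L} - {x}. \<Prod>k=1..\<eta> z. 1 / r z k)" for \<eta>
    unfolding zr_weight_eq using assms by (intro prod.remove) auto
  have "(\<Prod>z\<in>{1..L} - {x}. \<Prod>k=1..add_particle x \<zeta> z. 1 / r z k) =
      (\<Prod>z\<in>{1..L} - {x}. \<Prod>k=1..\<zeta> z. 1 / r z k)"
    by (intro prod.cong) (auto simp: add_particle_def)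
  moreover have "(\<Prod>k=1..add_particle x \<zeta> x. 1 / r x k) * r x (Suc (\<zeta> x)) = (\<Prod>k=1..\<zeta> x. 1 / r x k)"
    using r_pos[OF assms, of "Suc (\<zeta> x)"] by (simp add: add_particle_def)
  ultimately show ?thesis unfolding split by (simp add: mult_ac)
qed

text \<open>The rate vanishes where \<open>x\<close> is empty, and all other states arise from a
  unique \<zeta> by adding a particle at \<open>x\<close>. There weight times rate is the weight of
  \<zeta>.\<close>

lemma sum_states_Suc:
  assumes x: "x \<in> {1..L}"
  shows "(\<Sum>\<eta>\<in>zr_states L (Suc M). zr_weight L r \<eta> * (r x (\<eta> x) * G \<eta>)) =
    (\<Sum>\<zeta>\<in>zr_states L M. zr_weight L r \<zeta> * G (add_particle x \<zeta>))"
proof -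
  have "(\<Sum>\<eta>\<in>zr_states L (Suc M). zr_weight L r \<eta> * (r x (\<eta> x) * G \<eta>)) =
      (\<Sum>\<eta>\<in>add_particle x ` zr_states L M. zr_weight L r \<eta> * (r x (\<eta> x) * G \<eta>))"
  proof (rule sum.mono_neutral_right)
    show "add_particle x ` zr_states L M \<subseteq> zr_states L (Suc M)"
      using add_particle_in_states x by auto
    show "\<forall>\<eta>\<in>zr_states L (Suc M) - add_particle x ` zr_states L M.
        zr_weight L r \<eta> * (r x (\<eta> x) * G \<eta>) = 0"
    proof
      fix \<eta> assume "\<eta> \<in> zr_states L (Suc M) - add_particle x ` zr_states L M"
      then have "\<eta> x = 0" using remove_particle[OF x, of \<eta> M] by blast
      then show "zr_weight L r \<eta> * (r x (\<eta> x) * G \<eta>) = 0" using r_0[OF x] by simp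
    qed
  qed (rule finite_zr_states)
  also have "\<dots> = (\<Sum>\<zeta>\<in>zr_states L M. zr_weight L r (add_particle x \<zeta>) *
      (r x (add_particle x \<zeta> x) * G (add_particle x \<zeta>)))"
  proof (rule sum.reindex_cong[OF _ refl refl])
    have "(add_particle x \<zeta>)(x := add_particle x \<zeta> x - 1) = \<zeta>" for \<zeta>
      by (simp add: add_particle_def)
    then show "inj_on (add_particle x) (zr_states L M)"
      by (metis inj_on_inverseI[of _ "\<lambda>\<eta>. \<eta>(x := \<eta> x - 1)"])
  qed
  also have "\<dots> = (\<Sum>\<zeta>\<in>zr_states L M. zr_weight L r \<zeta> * G (add_particle x \<zeta>))"
  proof (rule sum.cong[OF refl])
    fix \<zeta>
    show "zr_weight L r (add_particle x \<zeta>) * (r x (add_particle x \<zeta> x) * G (add_particle x \<zeta>))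
       = zr_weight L r \<zeta> * G (add_particle x \<zeta>)"
      using zr_weight_add_particle[OF x, of \<zeta>] by (simp add: add_particle_def)
  qed
  finally show ?thesis .
qed

text \<open>Reversibility in usable form: on the right, source and target of a jump play symmetric
  roles, so \<open>G\<close> may be symmetrised in \<open>x\<close> and \<open>y\<close>.\<close>

lemma sum_rate_Suc:
  "(\<Sum>\<eta>\<in>zr_states L (Suc M). zr_weight L r \<eta> *
      (\<Sum>x=1..L. \<Sum>y=1..L. zr_rate L r \<eta> x y * G \<eta> (zr_move x y \<eta>))) =
    1 / L * (\<Sum>\<zeta>\<in>zr_states L M. zr_weight L r \<zeta> *
      (\<Sum>x=1..L. \<Sum>y=1..L. G (add_particle x \<zeta>) (add_particle y \<zeta>)))"
proof -
  have "(\<Sum>\<eta>\<in>zr_states L (Suc M). zr_weight L r \<eta> *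
      (\<Sum>x=1..L. \<Sum>y=1..L. zr_rate L r \<eta> x y * G \<eta> (zr_move x y \<eta>))) =
    (\<Sum>\<eta>\<in>zr_states L (Suc M). \<Sum>x=1..L. zr_weight L r \<eta> * (r x (\<eta> x) *
      (\<Sum>y=1..L. 1 / L * G \<eta> (zr_move x y \<eta>))))"
    by (simp add: zr_rate_def sum_distrib_left mult_ac)
  also have "\<dots> = (\<Sum>x=1..L. \<Sum>\<eta>\<in>zr_states L (Suc M). zr_weight L r \<eta> * (r x (\<eta> x) *
      (\<Sum>y=1..L. 1 / L * G \<eta> (zr_move x y \<eta>))))"
    by (rule sum.swap)
  also have "\<dots> = (\<Sum>x=1..L. \<Sum>\<zeta>\<in>zr_states L M. zr_weight L r \<zeta> *
      (\<Sum>y=1..L. 1 / L * G (add_particle x \<zeta>) (add_particle y \<zeta>)))"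
    by (rule sum.cong[OF refl]) (simp only: sum_states_Suc zr_move_add_particle)
  also have "\<dots> = (\<Sum>\<zeta>\<in>zr_states L M. \<Sum>x=1..L. zr_weight L r \<zeta> *
      (\<Sum>y=1..L. 1 / L * G (add_particle x \<zeta>) (add_particle y \<zeta>)))"
    by (rule sum.swap)
  also have "\<dots> = 1 / L * (\<Sum>\<zeta>\<in>zr_states L M. zr_weight L r \<zeta> *
      (\<Sum>x=1..L. \<Sum>y=1..L. G (add_particle x \<zeta>) (add_particle y \<zeta>)))"
    by (simp add: sum_distrib_left mult_ac)
  finally show ?thesis .
qed

text \<open>Stationarity: the summand in \<open>sum_rate_Suc\<close> is antisymmetric, and without
  particles all rates vanish.\<close>

lemma sum_generator: "(\<Sum>\<eta>\<in>zr_states L N. zr_weight L r \<eta> * zr_generator L r F \<eta>) = 0"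
proof (cases N)
  case 0
  have "zr_rate L r \<eta> x y = 0" if "\<eta> \<in> zr_states L 0" "x \<in> {1..L}" for \<eta> x y
    using that r_0 by (auto simp: zr_rate_def zr_states_def)
  then show ?thesis unfolding 0 zr_generator_def by simp
next
  case (Suc M)
  show ?thesis unfolding Suc zr_generator_def
    using sum_rate_Suc[where G = "\<lambda>\<eta> \<eta>'. F \<eta>' - F \<eta>"] by (simp add: sum_delta_antisym)
qed

text \<open>Compared with \<zeta>, only the rate at \<open>x\<close> changes. Its increment makes
  the added particle jump to a uniformly chosen site, which is relaxation towards the mean.\<close>

lemma generator_add_particle:
  assumes x: "x \<in> {1..L}"
  shows "zr_generator L r f (add_particle x \<zeta>) =
    (\<Sum>z=1..L. \<Sum>v=1..L. zr_rate L r \<zeta> z v * (f (add_particle x (zr_move z v \<zeta>)) - f (add_particle x \<zeta>)))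
    + (r x (\<zeta> x + 1) - r x (\<zeta> x)) * (mean {1..L} (\<lambda>v. f (add_particle v \<zeta>)) - f (add_particle x \<zeta>))"
proof -
  define b where "b = r x (\<zeta> x + 1) - r x (\<zeta> x)"
  have "zr_rate L r (add_particle x \<zeta>) z v * (f (zr_move z v (add_particle x \<zeta>)) - f (add_particle x \<zeta>)) =
      zr_rate L r \<zeta> z v * (f (add_particle x (zr_move z v \<zeta>)) - f (add_particle x \<zeta>))
      + (if z = x then b / L * (f (add_particle v \<zeta>) - f (add_particle x \<zeta>)) else 0)"
    if z: "z \<in> {1..L}" for z v
  proof (cases "z = x")
    case True
    \<comment> \<open>Particles at \<open>x\<close> are indistinguishable: if \<zeta> has one there,
      moving it or the added one gives the same state. If not, the rate is 0.\<close>
    have "zr_rate L r \<zeta> x v * (f (add_particle x (zr_move x v \<zeta>)) - f (add_particle x \<zeta>)) =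
        zr_rate L r \<zeta> x v * (f (add_particle v \<zeta>) - f (add_particle x \<zeta>))"
      using r_0[OF x] zr_move_add_particle'[of \<zeta> x v x]
      by (cases "\<zeta> x > 0") (auto simp: zr_rate_def zr_move_add_particle)
    moreover have "zr_rate L r (add_particle x \<zeta>) x v = zr_rate L r \<zeta> x v + b / L"
      by (simp add: zr_rate_def add_particle_def b_def diff_divide_distrib)
    ultimately show ?thesis unfolding True zr_move_add_particle
      by (simp only: distrib_right if_True simp_thms)
  next
    case False
    then have "zr_rate L r (add_particle x \<zeta>) z v = zr_rate L r \<zeta> z v"
      by (simp add: zr_rate_def add_particle_def)
    then show ?thesis using False r_0[OF z] zr_move_add_particle'[of \<zeta> z v x]
      by (cases "\<zeta> z > 0") (auto simp: zr_rate_def)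
  qed
  then have "zr_generator L r f (add_particle x \<zeta>) = (\<Sum>z=1..L. \<Sum>v=1..L.
      zr_rate L r \<zeta> z v * (f (add_particle x (zr_move z v \<zeta>)) - f (add_particle x \<zeta>))
      + (if z = x then b / L * (f (add_particle v \<zeta>) - f (add_particle x \<zeta>)) else 0))"
    unfolding zr_generator_def by (intro sum.cong refl) auto
  also have "\<dots> = (\<Sum>z=1..L. \<Sum>v=1..L. zr_rate L r \<zeta> z v * (f (add_particle x (zr_move z v \<zeta>)) - f (add_particle x \<zeta>)))
    + (\<Sum>z=1..L. if z = x then (\<Sum>v=1..L. b / L * (f (add_particle v \<zeta>) - f (add_particle x \<zeta>))) else 0)"
    unfolding sum.distrib by (intro arg_cong2[of _ _ _ _ "(+)"] refl sum.cong) auto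
  also have "(\<Sum>z=1..L. if z = x then (\<Sum>v=1..L. b / L * (f (add_particle v \<zeta>) - f (add_particle x \<zeta>))) else 0)
      = (\<Sum>v=1..L. b / L * (f (add_particle v \<zeta>) - f (add_particle x \<zeta>)))"
    using x by simp
  also have "\<dots> = b * (mean {1..L} (\<lambda>v. f (add_particle v \<zeta>)) - f (add_particle x \<zeta>))"
    using L unfolding sum_distrib_left[symmetric] sum_subtractf
    by (simp add: mean_def field_simps)
  finally show ?thesis unfolding b_def .
qed

text \<open>The estimate holds for each \<zeta> up to the generator applied to
  \<open>edge_form\<close>; that term vanishes in the weighted sum by stationarity for
  \<open>M\<close> particles.\<close>

lemma edge_form_deriv_generator_le:
  fixes \<alpha> c \<delta> :: real
  assumes d: "sobolev_density \<phi> p q" and \<alpha>: "averaging_rate \<alpha> p q"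
    and c: "c \<ge> 0"
    and r: "\<And>x k. x \<in> {1..L} \<Longrightarrow> c \<le> r x (k + 1) - r x k"
      "\<And>x k. x \<in> {1..L} \<Longrightarrow> r x (k + 1) - r x k \<le> c + \<delta>"
    and f: "\<And>\<eta>. \<eta> \<in> zr_states L (Suc M) \<Longrightarrow> f \<eta> > 0"
  shows "(\<Sum>\<zeta>\<in>zr_states L M. zr_weight L r \<zeta> * edge_form_deriv p q L f (zr_generator L r f) \<zeta>) \<le>
    - (\<alpha> * c - \<delta>) * (\<Sum>\<zeta>\<in>zr_states L M. zr_weight L r \<zeta> * edge_form p L f \<zeta>)"
proof -
  have pt: "edge_form_deriv p q L f (zr_generator L r f) \<zeta> \<le>
      zr_generator L r (edge_form p L f) \<zeta> + - (\<alpha> * c - \<delta>) * edge_form p L f \<zeta>"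
    if \<zeta>: "\<zeta> \<in> zr_states L M" for \<zeta>
  proof -
    define g where "g x = f (add_particle x \<zeta>)" for x
    define g' where "g' z v x = f (add_particle x (zr_move z v \<zeta>))" for z v x
    define b where "b x = r x (\<zeta> x + 1) - r x (\<zeta> x)" for x
    define D where "D x y = dPhi p q (g x) (g y)" for x y
    define m where "m = mean {1..L} g"
    define s where "s x = (\<Sum>z=1..L. \<Sum>v=1..L. zr_rate L r \<zeta> z v * (g' z v x - g x))" for x
    have g: "g x > 0" if "x \<in> {1..L}" for x
      unfolding g_def using that f add_particle_in_states \<zeta> by blast
    have g': "g' z v x > 0" if "x \<in> {1..L}" "z \<in> {1..L}" "v \<in> {1..L}" for x z v
      unfolding g'_def using that f add_particle_in_states zr_move_in_states \<zeta> by blast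
    have gen: "zr_generator L r f (add_particle x \<zeta>) = s x + b x * (m - g x)"
      if "x \<in> {1..L}" for x
    proof -
      have "g = (\<lambda>v. f (add_particle v \<zeta>))" by (simp add: g_def fun_eq_iff)
      then show ?thesis
        using generator_add_particle[OF that, of f \<zeta>] by (simp only: s_def g'_def b_def m_def)
    qed
    have split: "edge_form_deriv p q L f (zr_generator L r f) \<zeta> =
        (\<Sum>x=1..L. \<Sum>y=1..L. 2 * D x y * s x) + 2 * (\<Sum>x=1..L. b x * (\<Sum>y=1..L. D x y * (m - g x)))"
    proof -
      have "edge_form_deriv p q L f (zr_generator L r f) \<zeta> = 2 * (\<Sum>x=1..L. \<Sum>y=1..L. D x y *
        (s x + b x * (m - g x)))"
      unfolding edge_form_deriv_def D_def g_def[symmetric] using gen by simp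
      also have "\<dots> = (\<Sum>x=1..L. \<Sum>y=1..L. 2 * D x y * s x)
        + 2 * (\<Sum>x=1..L. b x * (\<Sum>y=1..L. D x y * (m - g x)))"
      unfolding sum_distrib_left sum.distrib[symmetric]
      by (intro sum.cong refl) (simp add: distrib_left mult.assoc mult.left_commute)
      finally show ?thesis .
    qed
    \<comment> \<open>The sums are exchanged until the jump \<open>(z, v)\<close> is outermost, so
      that a single jump of \<zeta> can be treated for all pairs \<open>(x, y)\<close> at
      once.\<close>
    have "(\<Sum>x=1..L. \<Sum>y=1..L. 2 * D x y * s x) =
        (\<Sum>x=1..L. \<Sum>y=1..L. \<Sum>z=1..L. \<Sum>v=1..L. zr_rate L r \<zeta> z v * (2 * (D x y * (g' z v x - g x))))"
      unfolding s_def sum_distrib_left by (simp add: mult.assoc mult.left_commute)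
    also have "\<dots> = (\<Sum>x=1..L. \<Sum>z=1..L. \<Sum>y=1..L. \<Sum>v=1..L. zr_rate L r \<zeta> z v * (2 * (D x y * (g' z v x - g x))))"
      by (intro sum.cong[OF refl] sum.swap)
    also have "\<dots> = (\<Sum>z=1..L. \<Sum>x=1..L. \<Sum>y=1..L. \<Sum>v=1..L. zr_rate L r \<zeta> z v * (2 * (D x y * (g' z v x - g x))))"
      by (rule sum.swap)
    also have "\<dots> = (\<Sum>z=1..L. \<Sum>x=1..L. \<Sum>v=1..L. \<Sum>y=1..L. zr_rate L r \<zeta> z v * (2 * (D x y * (g' z v x - g x))))"
      by (intro sum.cong[OF refl] sum.swap)
    also have "\<dots> = (\<Sum>z=1..L. \<Sum>v=1..L. \<Sum>x=1..L. \<Sum>y=1..L. zr_rate L r \<zeta> z v * (2 * (D x y * (g' z v x - g x))))"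
      by (intro sum.cong[OF refl] sum.swap)
    also have "\<dots> = (\<Sum>z=1..L. \<Sum>v=1..L. zr_rate L r \<zeta> z v * (2 * (\<Sum>x=1..L. \<Sum>y=1..L. D x y * (g' z v x - g x))))"
      by (simp add: sum_distrib_left)
    also have "\<dots> \<le> zr_generator L r (edge_form p L f) \<zeta>"
      unfolding zr_generator_def
    proof (intro sum_mono mult_left_mono)
      fix z v assume zv: "z \<in> {1..L}" "v \<in> {1..L}"
      show "0 \<le> zr_rate L r \<zeta> z v" using r_nonneg zv by (simp add: zr_rate_def)
      \<comment> \<open>The factor 2 is spread over both arguments: the common jump changes
        \<open>g x\<close> and \<open>g y\<close> together, which is where joint convexity is
        used.\<close>
      have "2 * (\<Sum>x=1..L. \<Sum>y=1..L. D x y * (g' z v x - g x)) =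
         (\<Sum>x=1..L. \<Sum>y=1..L. D x y * (g' z v x - g x)) + (\<Sum>x=1..L. \<Sum>y=1..L. D y x * (g' z v y - g y))"
        using sum.swap[of "\<lambda>x y. D x y * (g' z v x - g x)" "{1..L}" "{1..L}"] by simp
      also have "\<dots> = (\<Sum>x=1..L. \<Sum>y=1..L. D x y * (g' z v x - g x) + D y x * (g' z v y - g y))"
        by (simp add: sum.distrib)
      also have "\<dots> \<le> (\<Sum>x=1..L. \<Sum>y=1..L. Phi p (g' z v x) (g' z v y) - Phi p (g x) (g y))"
        unfolding D_def using g g' zv by (intro sum_mono sobolev_density_tangent[OF d])
      also have "\<dots> = edge_form p L f (zr_move z v \<zeta>) - edge_form p L f \<zeta>"
        by (simp add: edge_form_def g_def g'_def sum_subtractf)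
      finally show "2 * (\<Sum>x=1..L. \<Sum>y=1..L. D x y * (g' z v x - g x)) \<le>
          edge_form p L f (zr_move z v \<zeta>) - edge_form p L f \<zeta>" .
    qed
    finally have common: "(\<Sum>x=1..L. \<Sum>y=1..L. 2 * D x y * s x) \<le> zr_generator L r (edge_form p L f) \<zeta>" .
    have "2 * (\<Sum>x=1..L. b x * (\<Sum>y=1..L. D x y * (m - g x))) \<le> - (\<alpha> * c - \<delta>) * edge_form p L f \<zeta>"
      unfolding D_def m_def edge_form_def g_def[symmetric]
    proof (rule perturbed_averaging[OF d \<alpha> _ _ g c])
      show "{1..L} \<noteq> {}" using L by simp
      show "c \<le> b x" "b x \<le> c + \<delta>" if "x \<in> {1..L}" for x
        unfolding b_def using r that by blast+
    qed simp_all
    then show ?thesis using split common by linarith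
  qed
  have "(\<Sum>\<zeta>\<in>zr_states L M. zr_weight L r \<zeta> * edge_form_deriv p q L f (zr_generator L r f) \<zeta>) \<le>
      (\<Sum>\<zeta>\<in>zr_states L M. zr_weight L r \<zeta> * (zr_generator L r (edge_form p L f) \<zeta> + - (\<alpha> * c - \<delta>) * edge_form p L f \<zeta>))"
    using zr_weight_pos by (intro sum_mono mult_left_mono pt) (auto intro: less_imp_le)
  also have "\<dots> = (\<Sum>\<zeta>\<in>zr_states L M. zr_weight L r \<zeta> * zr_generator L r (edge_form p L f) \<zeta>)
     + - (\<alpha> * c - \<delta>) * (\<Sum>\<zeta>\<in>zr_states L M. zr_weight L r \<zeta> * edge_form p L f \<zeta>)"
    unfolding sum_distrib_left sum.distrib[symmetric]
    by (intro sum.cong) (simp_all add: algebra_simps)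
  finally show ?thesis by (simp add: sum_generator)
qed

end

section \<open>The flow and the entropy production\<close>

context zero_range
begin

lemma zr_partition_pos: "zr_partition L N r > 0"
proof -
  have "(\<lambda>x\<in>{1..L}. if x = 1 then N else 0) \<in> zr_states L N"
    using L by (auto simp: zr_states_def)
  then show ?thesis
    unfolding zr_partition_def using zr_weight_pos by (intro sum_pos finite_zr_states) auto
qed

lemma edge_form_nonneg:
  assumes "sobolev_density \<phi> p q" "\<And>\<eta>. \<eta> \<in> zr_states L (Suc M) \<Longrightarrow> f \<eta> > 0" "\<zeta> \<in> zr_states L M"
  shows "edge_form p L f \<zeta> \<ge> 0"
  unfolding edge_form_def using assms add_particle_in_states
  by (intro sum_nonneg Phi_nonneg[OF assms(1)]) auto

text \<open>\<open>sum_rate_Suc\<close> gives the sum of \<open>p (g x) * (g y - g x)\<close>;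
  symmetrising it in \<open>x\<close> and \<open>y\<close> yields minus half of
  \<open>Phi\<close>.\<close>

lemma entropy_production:
  "(\<Sum>\<eta>\<in>zr_states L (Suc M). zr_weight L r \<eta> * (p (f \<eta>) * zr_generator L r f \<eta>)) =
    - (1 / (2 * L) * (\<Sum>\<zeta>\<in>zr_states L M. zr_weight L r \<zeta> * edge_form p L f \<zeta>))"
proof -
  define g where "g \<zeta> x = f (add_particle x \<zeta>)" for \<zeta> x
  have edge: "edge_form p L f \<zeta> = - 2 * (\<Sum>x=1..L. \<Sum>y=1..L. p (g \<zeta> x) * (g \<zeta> y - g \<zeta> x))" for \<zeta>
  proof -
    have "edge_form p L f \<zeta> = (\<Sum>x=1..L. \<Sum>y=1..L. - (p (g \<zeta> x) * (g \<zeta> y - g \<zeta> x)) - p (g \<zeta> y) * (g \<zeta> x - g \<zeta> y))"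
      unfolding edge_form_def Phi_def g_def by (intro sum.cong refl) (simp add: algebra_simps)
    also have "\<dots> = - (\<Sum>x=1..L. \<Sum>y=1..L. p (g \<zeta> x) * (g \<zeta> y - g \<zeta> x)) - (\<Sum>x=1..L. \<Sum>y=1..L. p (g \<zeta> y) * (g \<zeta> x - g \<zeta> y))"
      by (simp only: sum_subtractf sum_negf)
    also have "(\<Sum>x=1..L. \<Sum>y=1..L. p (g \<zeta> y) * (g \<zeta> x - g \<zeta> y)) = (\<Sum>x=1..L. \<Sum>y=1..L. p (g \<zeta> x) * (g \<zeta> y - g \<zeta> x))"
      by (rule sum.swap)
    finally show ?thesis by simp
  qed
  have "(\<Sum>\<eta>\<in>zr_states L (Suc M). zr_weight L r \<eta> * (p (f \<eta>) * zr_generator L r f \<eta>)) =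
    (\<Sum>\<eta>\<in>zr_states L (Suc M). zr_weight L r \<eta> *
      (\<Sum>x=1..L. \<Sum>y=1..L. zr_rate L r \<eta> x y * (p (f \<eta>) * (f (zr_move x y \<eta>) - f \<eta>))))"
    unfolding zr_generator_def sum_distrib_left by (intro sum.cong refl) (simp add: mult_ac)
  also have "\<dots> = 1 / L * (\<Sum>\<zeta>\<in>zr_states L M. zr_weight L r \<zeta> *
      (\<Sum>x=1..L. \<Sum>y=1..L. p (g \<zeta> x) * (g \<zeta> y - g \<zeta> x)))"
    unfolding g_def by (rule sum_rate_Suc[where G = "\<lambda>\<eta> \<eta>'. p (f \<eta>) * (f \<eta>' - f \<eta>)"])
  also have "\<dots> = - (1 / (2 * L) * (\<Sum>\<zeta>\<in>zr_states L M. zr_weight L r \<zeta> * edge_form p L f \<zeta>))"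
    unfolding edge by (simp add: sum_distrib_left sum_negf[symmetric] mult_ac)
  finally show ?thesis .
qed

text \<open>Differentiability is two-sided at every real time, so time 0 is no exception; positivity
  is guaranteed only forward in time.\<close>

definition zr_flow :: "nat \<Rightarrow> (real \<Rightarrow> (nat \<Rightarrow> nat) \<Rightarrow> real) \<Rightarrow> bool" where
  "zr_flow N u \<longleftrightarrow> (\<forall>\<eta>\<in>zr_states L N.
     (\<forall>t\<ge>0. u t \<eta> > 0) \<and>
     (\<forall>t. ((\<lambda>s. u s \<eta>) has_real_derivative zr_generator L r (u t) \<eta>) (at t)))"

lemma zr_flow_exists:
  assumes "\<And>\<eta>. \<eta> \<in> zr_states L N \<Longrightarrow> f \<eta> > 0"
  obtains u where "zr_flow N u" "\<And>\<eta>. \<eta> \<in> zr_states L N \<Longrightarrow> u 0 \<eta> = f \<eta>"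
proof -
  obtain u where u: "\<And>\<eta>. \<eta> \<in> zr_states L N \<Longrightarrow> u 0 \<eta> = f \<eta>"
    "\<And>t \<eta>. t \<ge> (0::real) \<Longrightarrow> \<eta> \<in> zr_states L N \<Longrightarrow> u t \<eta> > 0"
    "\<And>t \<eta>. \<eta> \<in> zr_states L N \<Longrightarrow> ((\<lambda>s. u s \<eta>) has_real_derivative
      (\<Sum>i\<in>{1..L} \<times> {1..L}. zr_rate L r \<eta> (fst i) (snd i) * (u t (zr_move (fst i) (snd i) \<eta>) - u t \<eta>))) (at t)"
  proof (rule jump_process_flow[of "zr_states L N" "{1..L} \<times> {1..L}" "\<lambda>i. zr_move (fst i) (snd i)"
        "\<lambda>i \<eta>. zr_rate L r \<eta> (fst i) (snd i)" f])
    show "zr_rate L r \<eta> (fst i) (snd i) \<ge> 0" if "i \<in> {1..L} \<times> {1..L}" for i \<eta>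
      using that r_nonneg by (auto simp: zr_rate_def)
  qed (use assms finite_zr_states zr_move_in_states in auto)
  have "zr_flow N u"
    using u unfolding zr_flow_def zr_generator_def sum.cartesian_product by (simp add: case_prod_beta)
  then show ?thesis using u(1) that by blast
qed

lemma zr_flow_pos: "zr_flow N u \<Longrightarrow> \<eta> \<in> zr_states L N \<Longrightarrow> t \<ge> 0 \<Longrightarrow> u t \<eta> > 0"
  by (simp add: zr_flow_def)

lemma zr_flow_deriv:
  "zr_flow N u \<Longrightarrow> \<eta> \<in> zr_states L N \<Longrightarrow>
    ((\<lambda>s. u s \<eta>) has_real_derivative zr_generator L r (u t) \<eta>) (at t)"
  by (simp add: zr_flow_def)

lemma edge_form_has_derivative:
  assumes d: "sobolev_density \<phi> p q" and u: "zr_flow (Suc M) u"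
    and \<zeta>: "\<zeta> \<in> zr_states L M" and t: "t \<ge> 0"
  shows "((\<lambda>s. edge_form p L (u s) \<zeta>) has_real_derivative
    edge_form_deriv p q L (u t) (zr_generator L r (u t)) \<zeta>) (at t)"
proof -
  define g where "g s x = u s (add_particle x \<zeta>)" for s x
  define h where "h x = zr_generator L r (u t) (add_particle x \<zeta>)" for x
  have g': "((\<lambda>s. g s x) has_real_derivative h x) (at t)" if "x \<in> {1..L}" for x
    unfolding g_def h_def using that \<zeta> by (intro zr_flow_deriv[OF u] add_particle_in_states)
  have pg': "((\<lambda>s. p (g s x)) has_real_derivative q (g t x) * h x) (at t)" if x: "x \<in> {1..L}" for x
  proof (rule DERIV_chain2[where f = p, OF _ g'[OF x]])
    have "g t x > 0" unfolding g_def using x \<zeta> t by (intro zr_flow_pos[OF u] add_particle_in_states)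
    then show "(p has_real_derivative q (g t x)) (at (g t x))"
      using d by (simp add: sobolev_density_def)
  qed
  have "((\<lambda>s. edge_form p L (u s) \<zeta>) has_real_derivative
     (\<Sum>x=1..L. \<Sum>y=1..L. dPhi p q (g t x) (g t y) * h x + dPhi p q (g t y) (g t x) * h y)) (at t)"
    unfolding edge_form_def g_def[symmetric]
  proof (intro DERIV_sum)
    fix x y assume xy: "x \<in> {1..L}" "y \<in> {1..L}"
    show "((\<lambda>s. Phi p (g s x) (g s y)) has_real_derivative
        dPhi p q (g t x) (g t y) * h x + dPhi p q (g t y) (g t x) * h y) (at t)"
      unfolding Phi_def dPhi_def
      by (rule derivative_eq_intros pg'[OF xy(1)] pg'[OF xy(2)] g'[OF xy(1)] g'[OF xy(2)] refl
          | simp add: algebra_simps)+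
  qed
  also have "(\<Sum>x=1..L. \<Sum>y=1..L. dPhi p q (g t x) (g t y) * h x + dPhi p q (g t y) (g t x) * h y) =
      (\<Sum>x=1..L. \<Sum>y=1..L. dPhi p q (g t x) (g t y) * h x) + (\<Sum>x=1..L. \<Sum>y=1..L. dPhi p q (g t y) (g t x) * h y)"
    by (simp only: sum.distrib)
  also have "(\<Sum>x=1..L. \<Sum>y=1..L. dPhi p q (g t y) (g t x) * h y) = (\<Sum>x=1..L. \<Sum>y=1..L. dPhi p q (g t x) (g t y) * h x)"
    by (rule sum.swap)
  finally show ?thesis unfolding edge_form_deriv_def g_def h_def by (simp only: mult_2)
qed

definition total_edge_form where
  "total_edge_form p M f = (\<Sum>\<zeta>\<in>zr_states L M. zr_weight L r \<zeta> * edge_form p L f \<zeta>)"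

lemma total_edge_form_nonneg:
  assumes "sobolev_density \<phi> p q" "\<And>\<eta>. \<eta> \<in> zr_states L (Suc M) \<Longrightarrow> f \<eta> > 0"
  shows "total_edge_form p M f \<ge> 0"
  unfolding total_edge_form_def using edge_form_nonneg[OF assms] zr_weight_pos
  by (intro sum_nonneg mult_nonneg_nonneg) (auto intro: less_imp_le)

end

section \<open>Convergence to equilibrium and the entropy inequality\<close>

text \<open>Strict positivity of \<open>c\<close> gives \<open>2 * c - \<delta> \<ge> c > 0\<close>,
  hence convergence to equilibrium; \<open>c = 0\<close> is treated separately in the
  theorem.\<close>

locale zero_range_increments = zero_range +
  fixes c \<delta> :: real
  assumes c: "c > 0" and \<delta>: "\<delta> \<le> c"
    and incr_lower: "x \<in> {1..L} \<Longrightarrow> c \<le> r x (k + 1) - r x k"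
    and incr_upper: "x \<in> {1..L} \<Longrightarrow> r x (k + 1) - r x k \<le> c + \<delta>"
begin

lemma total_edge_form_has_derivative:
  assumes d: "sobolev_density \<phi> p q" and \<alpha>: "averaging_rate \<alpha> p q"
    and u: "zr_flow (Suc M) u" and t: "t \<ge> 0"
  obtains e where "((\<lambda>s. total_edge_form p M (u s)) has_real_derivative e) (at t)"
    and "e \<le> - (\<alpha> * c - \<delta>) * total_edge_form p M (u t)"
proof
  show "((\<lambda>s. total_edge_form p M (u s)) has_real_derivative
    (\<Sum>\<zeta>\<in>zr_states L M. zr_weight L r \<zeta> * edge_form_deriv p q L (u t) (zr_generator L r (u t)) \<zeta>)) (at t)"
    unfolding total_edge_form_def
    by (intro DERIV_sum DERIV_cmult edge_form_has_derivative[OF d u _ t])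
  show "(\<Sum>\<zeta>\<in>zr_states L M. zr_weight L r \<zeta> * edge_form_deriv p q L (u t) (zr_generator L r (u t)) \<zeta>)
      \<le> - (\<alpha> * c - \<delta>) * total_edge_form p M (u t)"
    unfolding total_edge_form_def
    by (rule edge_form_deriv_generator_le[OF d \<alpha> less_imp_le[OF c] incr_lower incr_upper zr_flow_pos[OF u _ t]])
qed

text \<open>The exponential decay of the quadratic form alone yields convergence to equilibrium, which
  is then available for every density.\<close>

lemma total_edge_form_square_tendsto:
  assumes u: "zr_flow (Suc M) u"
  shows "((\<lambda>t. total_edge_form (phi_pow' 2) M (u t)) \<longlongrightarrow> 0) at_top"
proof -
  \<comment> \<open>The rate for exponent 2, positive even when \<open>c - \<delta>\<close> is
    0.\<close>
  define \<kappa> where "\<kappa> = 2 * c - \<delta>"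
  have \<kappa>: "\<kappa> > 0" using c \<delta> by (simp add: \<kappa>_def)
  have d: "sobolev_density (phi_pow 2) (phi_pow' 2) (\<lambda>x. 2 * x powr (2 - 2))"
    by (rule sobolev_density_phi_pow) auto
  have \<alpha>: "averaging_rate 2 (phi_pow' 2) (\<lambda>x. 2 * x powr (2 - 2))"
    by (rule averaging_rate_phi_pow) auto
  define E where "E t = total_edge_form (phi_pow' 2) M (u t)" for t
  have E0: "E t \<ge> 0" if "t \<ge> 0" for t
    unfolding E_def using that by (intro total_edge_form_nonneg[OF d] zr_flow_pos[OF u])
  have decay: "exp (\<kappa> * t) * E t \<le> exp (\<kappa> * 0) * E 0" if t: "t \<ge> 0" for t
  proof (rule DERIV_nonpos_imp_nonincreasing[OF t])
    fix s :: real assume s: "0 \<le> s" "s \<le> t"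
    obtain e where e: "(E has_real_derivative e) (at s)" "e \<le> - \<kappa> * E s"
      unfolding E_def \<kappa>_def using total_edge_form_has_derivative[OF d \<alpha> u s(1)] by blast
    have "((\<lambda>t. exp (\<kappa> * t) * E t) has_real_derivative exp (\<kappa> * s) * (\<kappa> * E s + e)) (at s)"
      by (rule derivative_eq_intros e(1) refl | simp add: algebra_simps)+
    moreover have "exp (\<kappa> * s) * (\<kappa> * E s + e) \<le> 0"
      using e(2) by (intro mult_nonneg_nonpos) auto
    ultimately show "\<exists>y. ((\<lambda>t. exp (\<kappa> * t) * E t) has_real_derivative y) (at s) \<and> y \<le> 0" by blast
  qed
  have le: "E t \<le> E 0 * exp (- (\<kappa> * t))" if "t \<ge> 0" for t
    using decay[OF that] by (simp add: exp_minus divide_simps mult.commute)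
  have "((\<lambda>t. E 0 * exp (- (\<kappa> * t))) \<longlongrightarrow> 0) at_top"
  proof -
    have "filterlim (\<lambda>t. \<kappa> * t) at_top at_top"
      using \<kappa> by (intro filterlim_tendsto_pos_mult_at_top[OF tendsto_const _ filterlim_ident])
    then have "((\<lambda>t. exp (- (\<kappa> * t))) \<longlongrightarrow> 0) at_top"
      by (intro filterlim_compose[OF exp_at_bot] filterlim_compose[OF filterlim_uminus_at_bot_at_top])
    then show ?thesis by (auto intro: tendsto_mult_right_zero)
  qed
  then have "(E \<longlongrightarrow> 0) at_top"
    by (rule tendsto_sandwich[rotated -1, where f = "\<lambda>t. 0"])
      (use E0 le in \<open>auto simp: eventually_at_top_linorder\<close>)
  then show ?thesis unfolding E_def .
qed

text \<open>For exponent 2, \<open>Phi\<close> is twice the squared difference. This is one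
  nonnegative term of a total that tends to 0, and its weight is positive.\<close>

lemma edge_difference_tendsto:
  assumes u: "zr_flow (Suc M) u" and \<zeta>: "\<zeta> \<in> zr_states L M" and xy: "x \<in> {1..L}" "y \<in> {1..L}"
  shows "((\<lambda>t. u t (add_particle x \<zeta>) - u t (add_particle y \<zeta>)) \<longlongrightarrow> 0) at_top"
proof -
  let ?p = "phi_pow' 2"
  have d: "sobolev_density (phi_pow 2) ?p (\<lambda>x. 2 * x powr (2 - 2))"
    by (rule sobolev_density_phi_pow) auto
  let ?D = "\<lambda>t. u t (add_particle x \<zeta>) - u t (add_particle y \<zeta>)"
  have bd: "(?D t)\<^sup>2 \<le> 1 / (2 * zr_weight L r \<zeta>) * total_edge_form ?p M (u t)" if t: "t \<ge> 0" for t
  proof -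
    have pos: "u t \<eta> > 0" if "\<eta> \<in> zr_states L (Suc M)" for \<eta>
      using zr_flow_pos[OF u that t] .
    have P: "Phi ?p (u t (add_particle v \<zeta>)) (u t (add_particle w \<zeta>)) \<ge> 0"
      if "v \<in> {1..L}" "w \<in> {1..L}" for v w
      using that \<zeta> by (intro Phi_nonneg[OF d] pos add_particle_in_states)
    have "2 * (?D t)\<^sup>2 = Phi ?p (u t (add_particle x \<zeta>)) (u t (add_particle y \<zeta>))"
      using pos[OF add_particle_in_states[OF xy(1) \<zeta>]] pos[OF add_particle_in_states[OF xy(2) \<zeta>]]
      by (simp add: Phi_def phi_pow'_def power2_eq_square algebra_simps)
    also have "\<dots> \<le> (\<Sum>w=1..L. Phi ?p (u t (add_particle x \<zeta>)) (u t (add_particle w \<zeta>)))"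
      using xy P by (intro member_le_sum[where f = "\<lambda>w. Phi ?p (u t (add_particle x \<zeta>)) (u t (add_particle w \<zeta>))"]) auto
    also have "\<dots> \<le> edge_form ?p L (u t) \<zeta>"
      unfolding edge_form_def using xy P
      by (intro member_le_sum[where f = "\<lambda>v. \<Sum>w=1..L. Phi ?p (u t (add_particle v \<zeta>)) (u t (add_particle w \<zeta>))"])
        (auto intro!: sum_nonneg)
    finally have "zr_weight L r \<zeta> * (2 * (?D t)\<^sup>2) \<le> zr_weight L r \<zeta> * edge_form ?p L (u t) \<zeta>"
      using zr_weight_pos less_imp_le by (intro mult_left_mono) auto
    also have "\<dots> \<le> total_edge_form ?p M (u t)"
      unfolding total_edge_form_def using zr_weight_pos \<zeta>
      by (intro member_le_sum[where f = "\<lambda>\<zeta>. zr_weight L r \<zeta> * edge_form ?p L (u t) \<zeta>"] finite_zr_states)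
        (auto intro!: mult_nonneg_nonneg edge_form_nonneg[OF d] pos intro: less_imp_le)
    finally show ?thesis using zr_weight_pos[of \<zeta>] by (simp add: field_simps)
  qed
  have "((\<lambda>t. (?D t)\<^sup>2) \<longlongrightarrow> 0) at_top"
  proof (rule tendsto_sandwich[OF _ _ tendsto_const])
    show "((\<lambda>t. 1 / (2 * zr_weight L r \<zeta>) * total_edge_form ?p M (u t)) \<longlongrightarrow> 0) at_top"
      using total_edge_form_square_tendsto[OF u] by (rule tendsto_mult_right_zero)
    show "\<forall>\<^sub>F t in at_top. (?D t)\<^sup>2 \<le> 1 / (2 * zr_weight L r \<zeta>) * total_edge_form ?p M (u t)"
      using bd by (auto simp: eventually_at_top_linorder)
  qed auto
  then show ?thesis by simp
qed

text \<open>Any state is connected to \<open>\<eta>\<^sub>0\<close> by moving particles to site 1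
  one at a time. The induction runs on the number of particles elsewhere, and the differences
  telescope.\<close>

lemma difference_tendsto:
  assumes u: "zr_flow (Suc M) u"
  defines "\<eta>\<^sub>0 \<equiv> (\<lambda>x\<in>{1..L}. if x = 1 then Suc M else 0)"
  assumes "\<eta> \<in> zr_states L (Suc M)"
  shows "((\<lambda>t. u t \<eta> - u t \<eta>\<^sub>0) \<longlongrightarrow> 0) at_top"
  using assms(3)
proof (induction "Suc M - \<eta> 1" arbitrary: \<eta> rule: less_induct)
  case less
  have split: "Suc M = \<eta> 1 + (\<Sum>x\<in>{1..L} - {1}. \<eta> x)"
    using less.prems L sum.remove[of "{1..L}" 1 \<eta>] by (simp add: zr_states_def)
  show ?case
  proof (cases "\<forall>x\<in>{1..L} - {1}. \<eta> x = 0")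
    case True
    then have "\<eta> 1 = Suc M" using split by simp
    then have "\<eta> = \<eta>\<^sub>0"
      using True less.prems by (intro ext) (auto simp: \<eta>\<^sub>0_def zr_states_def PiE_def extensional_def)
    then show ?thesis by simp
  next
    case False
    then obtain x where x: "x \<in> {1..L}" "x \<noteq> 1" "\<eta> x > 0" by blast
    obtain \<zeta> where \<zeta>: "\<zeta> \<in> zr_states L M" "\<eta> = add_particle x \<zeta>"
      using remove_particle[OF x(1) less.prems x(3)] .
    have 1: "1 \<in> {1..L}" using L by simp
    have "\<eta> x \<le> (\<Sum>x\<in>{1..L} - {1}. \<eta> x)" using x by (intro member_le_sum) auto
    then have "\<eta> 1 < Suc M" using split x(3) by simp
    moreover have "add_particle 1 \<zeta> 1 = Suc (\<eta> 1)" using x(2) \<zeta>(2) by (simp add: add_particle_def)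
    ultimately have "((\<lambda>t. u t (add_particle 1 \<zeta>) - u t \<eta>\<^sub>0) \<longlongrightarrow> 0) at_top"
      by (intro less.hyps add_particle_in_states 1 \<zeta>(1)) simp
    from tendsto_add[OF edge_difference_tendsto[OF u \<zeta>(1) x(1) 1] this]
    show ?thesis by (simp add: \<zeta>(2))
  qed
qed

text \<open>The weighted sum of \<open>u\<close> is conserved by stationarity, and
  \<open>u t \<eta>\<close> differs from the weighted mean only by an average of differences that
  tend to 0.\<close>

lemma zr_flow_tendsto_mean:
  assumes u: "zr_flow (Suc M) u" and \<eta>: "\<eta> \<in> zr_states L (Suc M)"
  shows "((\<lambda>t. u t \<eta>) \<longlongrightarrow>
    (\<Sum>\<xi>\<in>zr_states L (Suc M). zr_weight L r \<xi> * u 0 \<xi>) / zr_partition L (Suc M) r) at_top"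
proof -
  let ?S = "zr_states L (Suc M)"
  let ?Z = "zr_partition L (Suc M) r"
  define m where "m t = (\<Sum>\<xi>\<in>?S. zr_weight L r \<xi> * u t \<xi>)" for t
  have "(m has_real_derivative 0) (at t)" for t
  proof -
    have "(m has_real_derivative (\<Sum>\<xi>\<in>?S. zr_weight L r \<xi> * zr_generator L r (u t) \<xi>)) (at t)"
      unfolding m_def by (intro DERIV_sum DERIV_cmult zr_flow_deriv[OF u])
    then show ?thesis by (simp add: sum_generator)
  qed
  then have m: "m t = m 0" for t by (intro DERIV_isconst_all) auto
  have diff: "((\<lambda>t. u t \<eta> - u t \<xi>) \<longlongrightarrow> 0) at_top" if "\<xi> \<in> ?S" for \<xi>
    using tendsto_diff[OF difference_tendsto[OF u \<eta>] difference_tendsto[OF u that]] by simp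
  have "((\<lambda>t. (m 0 + (\<Sum>\<xi>\<in>?S. zr_weight L r \<xi> * (u t \<eta> - u t \<xi>))) / ?Z) \<longlongrightarrow>
     (m 0 + (\<Sum>\<xi>\<in>?S. zr_weight L r \<xi> * 0)) / ?Z) at_top"
    using zr_partition_pos[of "Suc M"] by (intro tendsto_intros diff) auto
  moreover have "(m 0 + (\<Sum>\<xi>\<in>?S. zr_weight L r \<xi> * (u t \<eta> - u t \<xi>))) / ?Z = u t \<eta>" for t
  proof -
    have "(\<Sum>\<xi>\<in>?S. zr_weight L r \<xi> * (u t \<eta> - u t \<xi>)) = ?Z * u t \<eta> - m t"
      by (simp add: m_def zr_partition_def right_diff_distrib sum_subtractf sum_distrib_right)
    then show ?thesis using m[of t] zr_partition_pos[of "Suc M"] by simp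
  qed
  ultimately show ?thesis by (simp add: m_def)
qed

lemma entropy_le_total_edge_form:
  assumes d: "sobolev_density \<phi> p q" and \<alpha>: "averaging_rate \<alpha> p q"
    and f: "\<And>\<eta>. \<eta> \<in> zr_states L (Suc M) \<Longrightarrow> f \<eta> > 0"
  defines "\<mu> \<equiv> (\<Sum>\<eta>\<in>zr_states L (Suc M). zr_weight L r \<eta> * f \<eta>) / zr_partition L (Suc M) r"
  shows "(\<alpha> * c - \<delta>) * (\<Sum>\<eta>\<in>zr_states L (Suc M). zr_weight L r \<eta> * (\<phi> (f \<eta>) - \<phi> \<mu>)) \<le>
    1 / (2 * L) * total_edge_form p M f"
proof -
  let ?S = "zr_states L (Suc M)"
  define \<kappa> where "\<kappa> = \<alpha> * c - \<delta>"
  obtain u where u: "zr_flow (Suc M) u" and u0: "\<And>\<eta>. \<eta> \<in> ?S \<Longrightarrow> u 0 \<eta> = f \<eta>"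
    using zr_flow_exists[of "Suc M" f, OF f] by blast
  \<comment> \<open>The density is differentiable only on the positive half-line; its continuity at
    the limit \<mu> depends on this.\<close>
  have \<mu>: "\<mu> > 0"
  proof -
    have "?S \<noteq> {}"
      using zr_partition_pos[of "Suc M"] by (auto simp: zr_partition_def)
    then show ?thesis
      unfolding \<mu>_def using zr_partition_pos zr_weight_pos f finite_zr_states
      by (intro divide_pos_pos sum_pos mult_pos_pos) auto
  qed
  define E where "E t = total_edge_form p M (u t)" for t
  define H where "H t = (\<Sum>\<eta>\<in>?S. zr_weight L r \<eta> * (\<phi> (u t \<eta>) - \<phi> \<mu>))" for t
  have H': "(H has_real_derivative - (1 / (2 * L) * E t)) (at t)" if t: "t \<ge> 0" for t
  proof -
    have "(H has_real_derivative (\<Sum>\<eta>\<in>?S. zr_weight L r \<eta> * (p (u t \<eta>) * zr_generator L r (u t) \<eta> - 0))) (at t)"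
      unfolding H_def
    proof (intro DERIV_sum DERIV_cmult DERIV_diff DERIV_const)
      fix \<eta> assume \<eta>: "\<eta> \<in> ?S"
      show "((\<lambda>t. \<phi> (u t \<eta>)) has_real_derivative p (u t \<eta>) * zr_generator L r (u t) \<eta>) (at t)"
        by (rule DERIV_chain2[where f = \<phi>, OF _ zr_flow_deriv[OF u \<eta>]])
          (use d zr_flow_pos[OF u \<eta> t] in \<open>simp add: sobolev_density_def\<close>)
    qed
    then show ?thesis by (simp add: entropy_production E_def total_edge_form_def)
  qed
  have decr: "1 / (2 * L) * E t - \<kappa> * H t \<le> 1 / (2 * L) * E 0 - \<kappa> * H 0" if t: "t \<ge> 0" for t
  proof (rule DERIV_nonpos_imp_nonincreasing[OF t])
    fix s :: real assume s: "0 \<le> s" "s \<le> t"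
    obtain e where e: "(E has_real_derivative e) (at s)" "e \<le> - \<kappa> * E s"
      unfolding E_def \<kappa>_def using total_edge_form_has_derivative[OF d \<alpha> u s(1)] by blast
    have "((\<lambda>t. 1 / (2 * L) * E t - \<kappa> * H t) has_real_derivative
        1 / (2 * L) * e - \<kappa> * (- (1 / (2 * L) * E s))) (at s)"
      by (intro DERIV_diff DERIV_cmult e(1) H' s(1))
    moreover have "1 / (2 * L) * e - \<kappa> * (- (1 / (2 * L) * E s)) \<le> 0"
    proof -
      have "1 / (2 * L) * (e + \<kappa> * E s) \<le> 0" using e(2) by (intro mult_nonneg_nonpos) auto
      then show ?thesis by (simp add: distrib_left)
    qed
    ultimately show "\<exists>y. ((\<lambda>t. 1 / (2 * L) * E t - \<kappa> * H t) has_real_derivative y) (at s) \<and> y \<le> 0"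
      by blast
  qed
  have "E t \<ge> 0" if "t \<ge> 0" for t
    unfolding E_def using that by (intro total_edge_form_nonneg[OF d] zr_flow_pos[OF u])
  then have le: "- (\<kappa> * H t) \<le> 1 / (2 * L) * E 0 - \<kappa> * H 0" if "t \<ge> 0" for t
    using decr[OF that] that by (smt (verit) divide_nonneg_nonneg mult_nonneg_nonneg of_nat_0_le_iff)
  have "(H \<longlongrightarrow> (\<Sum>\<eta>\<in>?S. zr_weight L r \<eta> * (\<phi> \<mu> - \<phi> \<mu>))) at_top"
    unfolding H_def
  proof (intro tendsto_sum tendsto_mult tendsto_diff tendsto_const)
    fix \<eta> assume \<eta>: "\<eta> \<in> ?S"
    have "((\<lambda>t. u t \<eta>) \<longlongrightarrow> \<mu>) at_top"
      using zr_flow_tendsto_mean[OF u \<eta>] u0 by (simp add: \<mu>_def)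
    moreover have "isCont \<phi> \<mu>"
      using d \<mu> by (intro DERIV_isCont[of \<phi> "p \<mu>"]) (simp add: sobolev_density_def)
    ultimately show "((\<lambda>t. \<phi> (u t \<eta>)) \<longlongrightarrow> \<phi> \<mu>) at_top"
      by (rule isCont_tendsto_compose[rotated])
  qed
  then have "((\<lambda>t. - (\<kappa> * H t)) \<longlongrightarrow> - (\<kappa> * 0)) at_top"
    by (intro tendsto_minus tendsto_mult tendsto_const) simp
  then have "- (\<kappa> * 0) \<le> 1 / (2 * L) * E 0 - \<kappa> * H 0"
    by (rule tendsto_upperbound) (use le in \<open>auto simp: eventually_at_top_linorder\<close>)
  \<comment> \<open>\<open>u 0\<close> agrees with \<open>f\<close> on the states alone, so the
    agreement is used inside the sums.\<close>
  moreover have "E 0 = total_edge_form p M f"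
    unfolding E_def total_edge_form_def edge_form_def using u0 add_particle_in_states
    by (intro sum.cong refl arg_cong2[of _ _ _ _ "(*)"] arg_cong2[of _ _ _ _ "Phi p"]) auto
  moreover have "H 0 = (\<Sum>\<eta>\<in>?S. zr_weight L r \<eta> * (\<phi> (f \<eta>) - \<phi> \<mu>))"
    unfolding H_def using u0 by (intro sum.cong) auto
  ultimately show ?thesis by (simp add: \<kappa>_def)
qed

end

section \<open>From weighted sums to the convex Sobolev inequality\<close>

context zero_range
begin

lemma zr_states_0: "zr_states L 0 = {\<lambda>x\<in>{1..L}. 0}"
proof -
  have "\<eta> \<in> zr_states L 0 \<longleftrightarrow> \<eta> = (\<lambda>x\<in>{1..L}. 0)" for \<eta>
    by (auto simp: zr_states_def PiE_def extensional_def fun_eq_iff)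
  then show ?thesis by blast
qed

lemma zr_entropy_eq:
  "zr_entropy L N r \<phi> f = 1 / zr_partition L N r * (\<Sum>\<eta>\<in>zr_states L N. zr_weight L r \<eta> *
     (\<phi> (f \<eta>) - \<phi> ((\<Sum>\<eta>\<in>zr_states L N. zr_weight L r \<eta> * f \<eta>) / zr_partition L N r)))"
proof -
  let ?Z = "zr_partition L N r"
  let ?\<mu> = "(\<Sum>\<eta>\<in>zr_states L N. zr_weight L r \<eta> * f \<eta>) / ?Z"
  have "(\<Sum>\<eta>\<in>zr_states L N. f \<eta> * zr_measure L N r \<eta>) = ?\<mu>"
    unfolding zr_measure_def sum_divide_distrib by (intro sum.cong) auto
  moreover have "(\<Sum>\<eta>\<in>zr_states L N. \<phi> (f \<eta>) * zr_measure L N r \<eta>) =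
      1 / ?Z * (\<Sum>\<eta>\<in>zr_states L N. zr_weight L r \<eta> * \<phi> (f \<eta>))"
    unfolding zr_measure_def sum_distrib_left by (intro sum.cong) auto
  moreover have "(\<Sum>\<eta>\<in>zr_states L N. zr_weight L r \<eta> * (\<phi> (f \<eta>) - \<phi> ?\<mu>)) =
      (\<Sum>\<eta>\<in>zr_states L N. zr_weight L r \<eta> * \<phi> (f \<eta>)) - ?Z * \<phi> ?\<mu>"
    unfolding zr_partition_def right_diff_distrib sum_subtractf sum_distrib_right ..
  ultimately show ?thesis
    using zr_partition_pos[of N] by (simp add: zr_entropy_def right_diff_distrib)
qed

text \<open>Dividing by the partition function turns the weights into the measure, and
  \<open>sum_rate_Suc\<close> turns the Dirichlet form into \<open>total_edge_form\<close>. With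
  \<open>N = 0\<close> there is a single state, and both sides are 0.\<close>

lemma convex_sobolev_if_entropy_le:
  assumes d: "sobolev_density \<phi> p q"
    and le: "\<And>M f. (\<And>\<eta>. \<eta> \<in> zr_states L (Suc M) \<Longrightarrow> f \<eta> > 0) \<Longrightarrow>
      \<kappa> * (\<Sum>\<eta>\<in>zr_states L (Suc M). zr_weight L r \<eta> * (\<phi> (f \<eta>) -
        \<phi> ((\<Sum>\<eta>\<in>zr_states L (Suc M). zr_weight L r \<eta> * f \<eta>) / zr_partition L (Suc M) r)))
      \<le> 1 / (2 * L) * total_edge_form p M f"
  shows "convex_sobolev L N r \<phi> \<kappa>"
  unfolding convex_sobolev_def
proof (intro allI impI)
  fix f :: "(nat \<Rightarrow> nat) \<Rightarrow> real" assume f: "\<forall>\<eta>\<in>zr_states L N. f \<eta> > 0"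
  have deriv: "deriv \<phi> a = p a" if "a > 0" for a
    using d that by (auto simp: sobolev_density_def intro!: DERIV_imp_deriv)
  show "\<kappa> * zr_entropy L N r \<phi> f \<le>
        1 / 2 * (\<Sum>\<eta>\<in>zr_states L N. \<Sum>x=1..L. \<Sum>y=1..L.
          zr_rate L r \<eta> x y * Phi_of \<phi> (f \<eta>) (f (zr_move x y \<eta>)) * zr_measure L N r \<eta>)"
  proof (cases N)
    case 0
    have "zr_entropy L 0 r \<phi> f = 0"
      using zr_weight_pos[of "\<lambda>x\<in>{1..L}. 0"] unfolding zr_entropy_eq zr_partition_def zr_states_0 by simp
    then show ?thesis unfolding 0 zr_states_0 by (simp add: zr_rate_def r_0)
  next
    case (Suc M)
    let ?Z = "zr_partition L (Suc M) r"
    have "(\<Sum>\<eta>\<in>zr_states L (Suc M). \<Sum>x=1..L. \<Sum>y=1..L.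
          zr_rate L r \<eta> x y * Phi_of \<phi> (f \<eta>) (f (zr_move x y \<eta>)) * zr_measure L (Suc M) r \<eta>)
       = (\<Sum>\<eta>\<in>zr_states L (Suc M). 1 / ?Z * (zr_weight L r \<eta> * (\<Sum>x=1..L. \<Sum>y=1..L.
          zr_rate L r \<eta> x y * Phi p (f \<eta>) (f (zr_move x y \<eta>)))))"
    proof (rule sum.cong[OF refl])
      fix \<eta> assume \<eta>: "\<eta> \<in> zr_states L (Suc M)"
      have "Phi_of \<phi> (f \<eta>) (f (zr_move x y \<eta>)) = Phi p (f \<eta>) (f (zr_move x y \<eta>))"
        if "x \<in> {1..L}" "y \<in> {1..L}" for x y
        using f \<eta> zr_move_in_states[OF that \<eta>] unfolding Suc by (simp add: Phi_of_def Phi_def deriv)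
      then show "(\<Sum>x=1..L. \<Sum>y=1..L.
          zr_rate L r \<eta> x y * Phi_of \<phi> (f \<eta>) (f (zr_move x y \<eta>)) * zr_measure L (Suc M) r \<eta>) =
          1 / ?Z * (zr_weight L r \<eta> * (\<Sum>x=1..L. \<Sum>y=1..L. zr_rate L r \<eta> x y * Phi p (f \<eta>) (f (zr_move x y \<eta>))))"
        unfolding sum_distrib_left zr_measure_def by (intro sum.cong refl) (simp add: mult_ac)
    qed
    also have "\<dots> = 1 / ?Z * (1 / L * total_edge_form p M f)"
      unfolding sum_distrib_left[symmetric] total_edge_form_def edge_form_def
      by (simp only: sum_rate_Suc[where G = "\<lambda>\<eta> \<eta>'. Phi p (f \<eta>) (f \<eta>')"])
    finally have rhs: "(\<Sum>\<eta>\<in>zr_states L (Suc M). \<Sum>x=1..L. \<Sum>y=1..L.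
          zr_rate L r \<eta> x y * Phi_of \<phi> (f \<eta>) (f (zr_move x y \<eta>)) * zr_measure L (Suc M) r \<eta>)
        = 1 / ?Z * (1 / L * total_edge_form p M f)" .
    have "1 / ?Z * (\<kappa> * (\<Sum>\<eta>\<in>zr_states L (Suc M). zr_weight L r \<eta> * (\<phi> (f \<eta>) -
        \<phi> ((\<Sum>\<eta>\<in>zr_states L (Suc M). zr_weight L r \<eta> * f \<eta>) / ?Z))))
      \<le> 1 / ?Z * (1 / (2 * L) * total_edge_form p M f)"
      using le[of M f] f zr_partition_pos[of "Suc M"] unfolding Suc by (intro mult_left_mono) auto
    then show ?thesis unfolding Suc zr_entropy_eq rhs by (simp add: mult_ac)
  qed
qed

lemma convex_sobolev_0:
  assumes d: "sobolev_density \<phi> p q"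
  shows "convex_sobolev L N r \<phi> 0"
  by (rule convex_sobolev_if_entropy_le[OF d]) (simp add: total_edge_form_nonneg[OF d])

end

lemma (in zero_range_increments) convex_sobolev_density:
  assumes "sobolev_density \<phi> p q" "averaging_rate \<alpha> p q"
  shows "convex_sobolev L N r \<phi> (\<alpha> * c - \<delta>)"
  by (rule convex_sobolev_if_entropy_le[OF assms(1)]) (rule entropy_le_total_edge_form[OF assms])

theorem theorem5p3:
  fixes L N :: nat and r :: "nat \<Rightarrow> nat \<Rightarrow> real" and c \<delta> :: real
  assumes "L \<ge> 1"
    and "\<forall>x\<in>{1..L}. r x 0 = 0"
    and "\<forall>x\<in>{1..L}. \<forall>k\<ge>1. r x k > 0"
    and "c \<ge> 0" and "\<delta> \<ge> 0" and "\<delta> \<le> c"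
    and "\<forall>x\<in>{1..L}. \<forall>k. c \<le> r x (k + 1) - r x k \<and> r x (k + 1) - r x k \<le> c + \<delta>"
  shows "(\<forall>\<phi>. admissible \<phi> \<longrightarrow> convex_sobolev L N r \<phi> (c - \<delta>))
    \<and> modified_log_sobolev L N r (c - \<delta>)
    \<and> (\<forall>\<alpha>\<in>{1<..2}. beckner L N r \<alpha> (\<alpha> * c - \<delta>))"
proof -
  interpret zero_range L r
    using assms(1-3) by unfold_locales auto
  have main: "convex_sobolev L N r \<phi> (\<alpha> * c - \<delta>)"
    if "sobolev_density \<phi> p q" "averaging_rate \<alpha> p q" for \<phi> p q \<alpha>
  proof (cases "c = 0")
    \<comment> \<open>Here \<open>0 \<le> \<delta> \<le> c\<close> forces
      \<open>\<delta> = 0\<close>, so the claimed constant is 0 and nonnegativity of the Dirichlet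
      form suffices.\<close>
    case True
    then show ?thesis using convex_sobolev_0[OF that(1)] assms(5,6) by simp
  next
    case False
    interpret zero_range_increments L r c \<delta>
      using assms(4-7) False by unfold_locales auto
    show ?thesis using convex_sobolev_density[OF that] .
  qed
  have main1: "convex_sobolev L N r \<phi> (c - \<delta>)" if "sobolev_density \<phi> p q" for \<phi> p q
    using main[OF that averaging_rate_1[OF that]] by simp
  show ?thesis
    unfolding modified_log_sobolev_def beckner_def
    using main1[OF sobolev_density_admissible] main1[OF sobolev_density_phi_one]
      main[OF sobolev_density_phi_pow averaging_rate_phi_pow]
    by auto
qed

end
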